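(* Let $D_2\xrightarrow{\partial_2}D_1\xrightarrow{\partial_1}S$ be a $2$-crossed module and let $\phi:S\to R$ be a morphism of $k$-algebras. Then $$\phi_*(D_2)\xrightarrow{\ \partial_{2_*}\ }\phi_*(D_1)\xrightarrow{\ \partial_{1_*}\ }R$$ is the induced $2$-crossed module, where $\phi_*(D_1)$ is generated as an algebra by the set $D_1\times R$ with defining relations $$(d_1,r_1)(d_1',r_1')=(d_1d_1',r_1r_1'),$$ $$(d_1,r)-(d_1',r)=(d_1-d_1',r),$$ $$(s\cdot d_1,r)=(d_1,\phi(s)r),$$ and $\phi_*(D_2)$ is generated as an algebra by the set $D_2\times R$ with defining relations $$\{(d_1,r_1)+(d_1',r_1'),(d_1'',r_1'')\}=\{(d_1,r_1),(d_1'',r_1'')\}+\{(d_1',r_1'),(d_1'',r_1'')\},$$ $$\{(d_1,r_1),(d_1',r_1')+(d_1'',r_1'')\}=\{(d_1,r_1),(d_1',r_1')\}+\{(d_1,r_1),(d_1'',r_1'')\},$$ $$(d_2,r_2)(d_2',r_2')=(d_2d_2',r_2r_2'),$$ $$(d_2,r)+(d_2',r)=(d_2+d_2',r),$$ $$(s\cdot d_2,r)=(d_2,\phi(s)r)$$ for any $d_1,d_1',d_1''\in D_1$, $d_2,d_2'\in D_2$, $s\in S$ and $r,r_1,r_1',r_1'',r_2,r_2'\in R$. Here $\{-,-\}:\phi_*(D_1)\times\phi_*(D_1)\to\phi_*(D_2)$ is the Peiffer lifting, given by $\{(d_1,r_1),(d_1',r_1')\}=(\{d_1,d_1'\},r_1r_1')$.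 The morphism $\partial_{2_*}:\phi_*(D_2)\to\phi_*(D_1)$ is given by $\partial_{2_*}(d_2,r)=(\partial_2(d_2),r)$, and the action of $\phi_*(D_1)$ on $\phi_*(D_2)$ by $(d_1,r_1)\cdot(d_2,r_2)=(d_1\cdot d_2,r_2)$, where $d_1\cdot d_2=\{d_1,\partial_2(d_2)\}$. The morphism $\partial_{1_*}:\phi_*(D_1)\to R$ is given by $\partial_{1_*}(d_1,r)=\phi(\partial_1(d_1))\,r$, and the actions of $R$ on $\phi_*(D_1)$ and $\phi_*(D_2)$ by $r\cdot(d_1,r_1)=(d_1,rr_1)$ and $r\cdot(d_2,r')=(d_2,rr')$ respectively.
   Context: Conventions. $k$ is a fixed commutative ring, all algebras are commutative $k$-algebras, and $R$ is a $k$-algebra with identity. An action of an algebra $P$ on an algebra $M$ is a $k$-bilinear map $P\times M\to M$, $(p,m)\mapsto p\cdot m$ (also written $m\cdot p$), with $p\cdot(mm')=(p\cdot m)m'$ and $(pp')\cdot m=p\cdot(p'\cdot m)$. A $2$-crossed module $\{L,M,P,\partial_2,\partial_1\}$ consists of a complex of $P$-algebras $L\xrightarrow{\partial_2}M\xrightarrow{\partial_1}P$ (so $\partial_1\partial_2=0$), together with an action of $P$ on all three algebras, the action of $P$ on itself being multiplication and $\partial_2,\partial_1$ being $P$-equivariant, and a $P$-bilinear map $\{-,-\}:M\times M\to L$ (the Peiffer lifting) such that for all $m,m_0,m_1,m_2\in M$, $l,l_0,l_1\in L$, $p\in P$: PL1: $\partial_2\{m_0,m_1\}=m_0m_1-\partial_1(m_1)\cdot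 m_0$; PL2: $\{\partial_2(l_0),\partial_2(l_1)\}=l_0l_1$; PL3: $\{m_0,m_1m_2\}=\{m_0m_1,m_2\}+\partial_1(m_2)\cdot\{m_0,m_1\}$; PL4: $\{m,\partial_2(l)\}-\{\partial_2(l),m\}=\partial_1(m)\cdot l$; PL5: $\{m_0,m_1\}\cdot p=\{m_0\cdot p,m_1\}=\{m_0,m_1\cdot p\}$. A morphism of $2$-crossed modules $(f_2,f_1,f_0):\{L,M,P,\partial_2,\partial_1\}\to\{L',M',P',\partial_2',\partial_1'\}$ consists of algebra morphisms $f_2:L\to L'$, $f_1:M\to M'$, $f_0:P\to P'$ with $f_0\partial_1=\partial_1'f_1$, $f_1\partial_2=\partial_2'f_2$, $f_1(p\cdot m)=f_0(p)\cdot f_1(m)$, $f_2(p\cdot l)=f_0(p)\cdot f_2(l)$ and $\{f_1(m),f_1(m')\}=f_2\{m,m'\}$ for all $m,m'\in M$, $l\in L$, $p\in P$. Induced $2$-crossed module: for a $2$-crossed module $\{D_2,D_1,S,\partial_2,\partial_1\}$ and a morphism of $k$-algebras $\phi:S\to R$, the induced $2$-crossed module is a $2$-crossed module $\{\phi_*(D_2),\phi_*(D_1),R,\partial_{2_*},\partial_{1_*}\}$ with a morphism $(\phi'',\phi',\phi)$ to it from $\{D_2,D_1,S,\partial_2,\partial_1\}$, such that for any morphism of $2$-crossed modules $(f_2,f_1,\phi):\{D_2,D_1,S,\partial_2,\partial_1\}\to\{B_2,B_1,R,\partial_2',\partial_1'\}$ there is a unique morphism of $2$-crossed modules $(f_{2_*},f_{1_*},\mathrm{id}_R):\{\phi_*(D_2),\phi_*(D_1),R,\partial_{2_*},\partial_{1_*}\}\to\{B_2,B_1,R,\partial_2',\partial_1'\}$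 with $(f_{2_*},f_{1_*},\mathrm{id}_R)\circ(\phi'',\phi',\phi)=(f_2,f_1,\phi)$.
   Formalization: Both algebras are generated as R-algebras with r·(d,r')=(d,rr'), so (d,r) is additive in r; (cd,r)=(d,cr) for c in k is added; the action of φ_*(D_1) reads (d_1,r_1)·(d_2,r_2)=(d_1·d_2,r_1r_2); an identity of P acts as the identity. *)

theory Defs
  imports "HOL-Algebra.Module"
begin

section \<open>Commutative algebras without identity, and actions\<close>

text \<open>
  The library locale \<^locale>\<open>algebra\<close> requires an identity in the algebra.  Here an algebra need
  not have one; the field \<^const>\<open>one\<close> of the record is ignored in that case.
\<close>

locale comm_alg = module K A for K :: "'k ring" and A :: "('k, 'a) module" +
  assumes mult_closed: "\<lbrakk>x \<in> carrier A; y \<in> carrier A\<rbrakk> \<Longrightarrow> x \<otimes>\<^bsub>A\<^esub> y \<in> carrier A"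
    and mult_assoc: "\<lbrakk>x \<in> carrier A; y \<in> carrier A; z \<in> carrier A\<rbrakk> \<Longrightarrow>
      (x \<otimes>\<^bsub>A\<^esub> y) \<otimes>\<^bsub>A\<^esub> z = x \<otimes>\<^bsub>A\<^esub> (y \<otimes>\<^bsub>A\<^esub> z)"
    and mult_comm: "\<lbrakk>x \<in> carrier A; y \<in> carrier A\<rbrakk> \<Longrightarrow> x \<otimes>\<^bsub>A\<^esub> y = y \<otimes>\<^bsub>A\<^esub> x"
    and mult_distr: "\<lbrakk>x \<in> carrier A; y \<in> carrier A; z \<in> carrier A\<rbrakk> \<Longrightarrow>
      (x \<oplus>\<^bsub>A\<^esub> y) \<otimes>\<^bsub>A\<^esub> z = x \<otimes>\<^bsub>A\<^esub> z \<oplus>\<^bsub>A\<^esub> y \<otimes>\<^bsub>A\<^esub> z"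
    and smult_mult: "\<lbrakk>c \<in> carrier K; x \<in> carrier A; y \<in> carrier A\<rbrakk> \<Longrightarrow>
      (c \<odot>\<^bsub>A\<^esub> x) \<otimes>\<^bsub>A\<^esub> y = c \<odot>\<^bsub>A\<^esub> (x \<otimes>\<^bsub>A\<^esub> y)"

definition alg_hom :: "'k ring \<Rightarrow> ('k, 'a) module \<Rightarrow> ('k, 'b) module \<Rightarrow> ('a \<Rightarrow> 'b) \<Rightarrow> bool" where
  "alg_hom K A B f \<longleftrightarrow>
     f \<in> carrier A \<rightarrow> carrier B \<and>
     (\<forall>x\<in>carrier A. \<forall>y\<in>carrier A. f (x \<oplus>\<^bsub>A\<^esub> y) = f x \<oplus>\<^bsub>B\<^esub> f y) \<and>
     (\<forall>x\<in>carrier A. \<forall>y\<in>carrier A. f (x \<otimes>\<^bsub>A\<^esub> y) = f x \<otimes>\<^bsub>B\<^esub> f y) \<and>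
     (\<forall>c\<in>carrier K. \<forall>x\<in>carrier A. f (c \<odot>\<^bsub>A\<^esub> x) = c \<odot>\<^bsub>B\<^esub> f x)"

definition bilinear_map ::
  "'k ring \<Rightarrow> ('k, 'a) module \<Rightarrow> ('k, 'b) module \<Rightarrow> ('k, 'c) module \<Rightarrow> ('a \<Rightarrow> 'b \<Rightarrow> 'c) \<Rightarrow> bool" where
  "bilinear_map K A B C f \<longleftrightarrow>
     (\<forall>x\<in>carrier A. \<forall>y\<in>carrier B. f x y \<in> carrier C) \<and>
     (\<forall>x\<in>carrier A. \<forall>x'\<in>carrier A. \<forall>y\<in>carrier B. f (x \<oplus>\<^bsub>A\<^esub> x') y = f x y \<oplus>\<^bsub>C\<^esub> f x' y) \<and>
     (\<forall>x\<in>carrier A. \<forall>y\<in>carrier B. \<forall>y'\<in>carrier B. f x (y \<oplus>\<^bsub>B\<^esub> y') = f x y \<oplus>\<^bsub>C\<^esub> f x y') \<and>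
     (\<forall>c\<in>carrier K. \<forall>x\<in>carrier A. \<forall>y\<in>carrier B. f (c \<odot>\<^bsub>A\<^esub> x) y = c \<odot>\<^bsub>C\<^esub> f x y) \<and>
     (\<forall>c\<in>carrier K. \<forall>x\<in>carrier A. \<forall>y\<in>carrier B. f x (c \<odot>\<^bsub>B\<^esub> y) = c \<odot>\<^bsub>C\<^esub> f x y)"

definition alg_action ::
  "'k ring \<Rightarrow> ('k, 'p) module \<Rightarrow> ('k, 'm) module \<Rightarrow> ('p \<Rightarrow> 'm \<Rightarrow> 'm) \<Rightarrow> bool" where
  "alg_action K P M act \<longleftrightarrow>
     bilinear_map K P M M act \<and>
     (\<forall>p\<in>carrier P. \<forall>m\<in>carrier M. \<forall>m'\<in>carrier M. act p (m \<otimes>\<^bsub>M\<^esub> m') = act p m \<otimes>\<^bsub>M\<^esub> m') \<and>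
     (\<forall>p\<in>carrier P. \<forall>p'\<in>carrier P. \<forall>m\<in>carrier M. act (p \<otimes>\<^bsub>P\<^esub> p') m = act p (act p' m))"

definition is_identity :: "('k, 'p) module \<Rightarrow> 'p \<Rightarrow> bool" where
  "is_identity P e \<longleftrightarrow> e \<in> carrier P \<and> (\<forall>p\<in>carrier P. e \<otimes>\<^bsub>P\<^esub> p = p)"


section \<open>2-crossed modules\<close>

record ('k, 'l, 'm, 'p) two_crossed =
  top_alg :: "('k, 'l) module"
  mid_alg :: "('k, 'm) module"
  base_alg :: "('k, 'p) module"
  bdry2 :: "'l \<Rightarrow> 'm"
  bdry1 :: "'m \<Rightarrow> 'p"
  act_top :: "'p \<Rightarrow> 'l \<Rightarrow> 'l"
  act_mid :: "'p \<Rightarrow> 'm \<Rightarrow> 'm"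
  lifting :: "'m \<Rightarrow> 'm \<Rightarrow> 'l"

text \<open>
  The assumptions \<open>unital_top\<close> and \<open>unital_mid\<close> are part of the algebras in the complex being
  \<open>P\<close>-algebras: if \<open>P\<close> has an identity, it acts as the identity map.  Bilinearity of the Peiffer
  lifting over \<open>P\<close> is \<open>lifting_bilinear\<close> together with \<open>PL5a\<close> and \<open>PL5b\<close>.
\<close>

locale two_crossed_module =
  fixes K :: "'k ring" and X :: "('k, 'l, 'm, 'p) two_crossed"
  fixes L M P d2 d1 aL aM h
  defines "L \<equiv> top_alg X" and "M \<equiv> mid_alg X" and "P \<equiv> base_alg X"
    and "d2 \<equiv> bdry2 X" and "d1 \<equiv> bdry1 X"
    and "aL \<equiv> act_top X" and "aM \<equiv> act_mid X" and "h \<equiv> lifting X"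
  assumes alg_top: "comm_alg K L"
    and alg_mid: "comm_alg K M"
    and alg_base: "comm_alg K P"
    and hom2: "alg_hom K L M d2"
    and hom1: "alg_hom K M P d1"
    and complex: "l \<in> carrier L \<Longrightarrow> d1 (d2 l) = \<zero>\<^bsub>P\<^esub>"
    and action_top: "alg_action K P L aL"
    and action_mid: "alg_action K P M aM"
    and unital_top: "\<lbrakk>is_identity P e; l \<in> carrier L\<rbrakk> \<Longrightarrow> aL e l = l"
    and unital_mid: "\<lbrakk>is_identity P e; m \<in> carrier M\<rbrakk> \<Longrightarrow> aM e m = m"
    and equivariant2: "\<lbrakk>p \<in> carrier P; l \<in> carrier L\<rbrakk> \<Longrightarrow> d2 (aL p l) = aM p (d2 l)"
    and equivariant1: "\<lbrakk>p \<in> carrier P; m \<in> carrier M\<rbrakk> \<Longrightarrow> d1 (aM p m) = p \<otimes>\<^bsub>P\<^esub> d1 m"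
    and lifting_bilinear: "bilinear_map K M M L h"
    and PL1: "\<lbrakk>m0 \<in> carrier M; m1 \<in> carrier M\<rbrakk> \<Longrightarrow>
      d2 (h m0 m1) = m0 \<otimes>\<^bsub>M\<^esub> m1 \<ominus>\<^bsub>M\<^esub> aM (d1 m1) m0"
    and PL2: "\<lbrakk>l0 \<in> carrier L; l1 \<in> carrier L\<rbrakk> \<Longrightarrow> h (d2 l0) (d2 l1) = l0 \<otimes>\<^bsub>L\<^esub> l1"
    and PL3: "\<lbrakk>m0 \<in> carrier M; m1 \<in> carrier M; m2 \<in> carrier M\<rbrakk> \<Longrightarrow>
      h m0 (m1 \<otimes>\<^bsub>M\<^esub> m2) = h (m0 \<otimes>\<^bsub>M\<^esub> m1) m2 \<oplus>\<^bsub>L\<^esub> aL (d1 m2) (h m0 m1)"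
    and PL4: "\<lbrakk>m \<in> carrier M; l \<in> carrier L\<rbrakk> \<Longrightarrow>
      h m (d2 l) \<ominus>\<^bsub>L\<^esub> h (d2 l) m = aL (d1 m) l"
    and PL5a: "\<lbrakk>m0 \<in> carrier M; m1 \<in> carrier M; p \<in> carrier P\<rbrakk> \<Longrightarrow>
      aL p (h m0 m1) = h (aM p m0) m1"
    and PL5b: "\<lbrakk>m0 \<in> carrier M; m1 \<in> carrier M; p \<in> carrier P\<rbrakk> \<Longrightarrow>
      aL p (h m0 m1) = h m0 (aM p m1)"

definition two_crossed_hom ::
  "'k ring \<Rightarrow> ('k, 'l, 'm, 'p) two_crossed \<Rightarrow> ('k, 'l2, 'm2, 'p2) two_crossed \<Rightarrow>
   ('l \<Rightarrow> 'l2) \<Rightarrow> ('m \<Rightarrow> 'm2) \<Rightarrow> ('p \<Rightarrow> 'p2) \<Rightarrow> bool" where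
  "two_crossed_hom K X Y f2 f1 f0 \<longleftrightarrow>
     alg_hom K (top_alg X) (top_alg Y) f2 \<and>
     alg_hom K (mid_alg X) (mid_alg Y) f1 \<and>
     alg_hom K (base_alg X) (base_alg Y) f0 \<and>
     (\<forall>m\<in>carrier (mid_alg X). f0 (bdry1 X m) = bdry1 Y (f1 m)) \<and>
     (\<forall>l\<in>carrier (top_alg X). f1 (bdry2 X l) = bdry2 Y (f2 l)) \<and>
     (\<forall>p\<in>carrier (base_alg X). \<forall>m\<in>carrier (mid_alg X).
        f1 (act_mid X p m) = act_mid Y (f0 p) (f1 m)) \<and>
     (\<forall>p\<in>carrier (base_alg X). \<forall>l\<in>carrier (top_alg X).
        f2 (act_top X p l) = act_top Y (f0 p) (f2 l)) \<and>
     (\<forall>m\<in>carrier (mid_alg X). \<forall>m'\<in>carrier (mid_alg X).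
        lifting Y (f1 m) (f1 m') = f2 (lifting X m m'))"

text \<open>
  The first argument carries the element types of the 2-crossed modules against which the
  universal property is tested; a theorem that leaves these types free asserts it for all of them.
  Maps are compared on carriers only.
\<close>

definition is_induced ::
  "('b2 \<times> 'b1) itself \<Rightarrow> 'k ring \<Rightarrow> ('k, 'l, 'm, 's) two_crossed \<Rightarrow> ('k, 'r) module \<Rightarrow> ('s \<Rightarrow> 'r) \<Rightarrow>
   ('k, 'i2, 'i1, 'r) two_crossed \<Rightarrow> ('l \<Rightarrow> 'i2) \<Rightarrow> ('m \<Rightarrow> 'i1) \<Rightarrow> bool" where
  "is_induced T K D R phi I phi2 phi1 \<longleftrightarrow>
     two_crossed_module K I \<and> base_alg I = R \<and> two_crossed_hom K D I phi2 phi1 phi \<and>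
     (\<forall>(B :: ('k, 'b2, 'b1, 'r) two_crossed) f2 f1.
        two_crossed_module K B \<and> base_alg B = R \<and> two_crossed_hom K D B f2 f1 phi \<longrightarrow>
        (\<exists>g2 g1.
           two_crossed_hom K I B g2 g1 id \<and>
           (\<forall>l\<in>carrier (top_alg D). g2 (phi2 l) = f2 l) \<and>
           (\<forall>m\<in>carrier (mid_alg D). g1 (phi1 m) = f1 m) \<and>
           (\<forall>g2' g1'.
              two_crossed_hom K I B g2' g1' id \<and>
              (\<forall>l\<in>carrier (top_alg D). g2' (phi2 l) = f2 l) \<and>
              (\<forall>m\<in>carrier (mid_alg D). g1' (phi1 m) = f1 m) \<longrightarrow>
              (\<forall>x\<in>carrier (top_alg I). g2' x = g2 x) \<and>
              (\<forall>y\<in>carrier (mid_alg I). g1' y = g1 y))))"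


section \<open>Commutative algebras given by generators and relations\<close>

text \<open>
  The commutative algebra over \<open>R\<close>, not necessarily with identity, on a set \<open>X\<close> of generators with
  defining relations \<open>E\<close> (pairs of terms to be identified): terms modulo the least congruence that
  contains \<open>E\<close> and the axioms of commutative \<open>R\<close>-algebras.
\<close>

datatype ('c, 'g) alg_term =
    Gen 'g
  | Zero
  | Neg "('c, 'g) alg_term"
  | Add "('c, 'g) alg_term" "('c, 'g) alg_term"
  | Mul "('c, 'g) alg_term" "('c, 'g) alg_term"
  | Scal 'c "('c, 'g) alg_term"

inductive_set alg_terms :: "('c, 'z) ring_scheme \<Rightarrow> 'g set \<Rightarrow> ('c, 'g) alg_term set"
  for R :: "('c, 'z) ring_scheme" and X :: "'g set" where
  Gen: "g \<in> X \<Longrightarrow> Gen g \<in> alg_terms R X"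
| Zero: "Zero \<in> alg_terms R X"
| Neg: "t \<in> alg_terms R X \<Longrightarrow> Neg t \<in> alg_terms R X"
| Add: "\<lbrakk>t \<in> alg_terms R X; u \<in> alg_terms R X\<rbrakk> \<Longrightarrow> Add t u \<in> alg_terms R X"
| Mul: "\<lbrakk>t \<in> alg_terms R X; u \<in> alg_terms R X\<rbrakk> \<Longrightarrow> Mul t u \<in> alg_terms R X"
| Scal: "\<lbrakk>a \<in> carrier R; t \<in> alg_terms R X\<rbrakk> \<Longrightarrow> Scal a t \<in> alg_terms R X"

inductive_set alg_cong ::
  "('c, 'z) ring_scheme \<Rightarrow> 'g set \<Rightarrow> (('c, 'g) alg_term \<times> ('c, 'g) alg_term) set \<Rightarrow>
   (('c, 'g) alg_term \<times> ('c, 'g) alg_term) set"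
  for R :: "('c, 'z) ring_scheme" and X :: "'g set"
    and E :: "(('c, 'g) alg_term \<times> ('c, 'g) alg_term) set" where
  rel: "\<lbrakk>(t, u) \<in> E; t \<in> alg_terms R X; u \<in> alg_terms R X\<rbrakk> \<Longrightarrow> (t, u) \<in> alg_cong R X E"
| refl: "t \<in> alg_terms R X \<Longrightarrow> (t, t) \<in> alg_cong R X E"
| sym: "(t, u) \<in> alg_cong R X E \<Longrightarrow> (u, t) \<in> alg_cong R X E"
| trans: "\<lbrakk>(t, u) \<in> alg_cong R X E; (u, v) \<in> alg_cong R X E\<rbrakk> \<Longrightarrow> (t, v) \<in> alg_cong R X E"
| neg_cong: "(t, t') \<in> alg_cong R X E \<Longrightarrow> (Neg t, Neg t') \<in> alg_cong R X E"
| add_cong: "\<lbrakk>(t, t') \<in> alg_cong R X E; (u, u') \<in> alg_cong R X E\<rbrakk> \<Longrightarrow>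
    (Add t u, Add t' u') \<in> alg_cong R X E"
| mul_cong: "\<lbrakk>(t, t') \<in> alg_cong R X E; (u, u') \<in> alg_cong R X E\<rbrakk> \<Longrightarrow>
    (Mul t u, Mul t' u') \<in> alg_cong R X E"
| scal_cong: "\<lbrakk>a \<in> carrier R; (t, t') \<in> alg_cong R X E\<rbrakk> \<Longrightarrow>
    (Scal a t, Scal a t') \<in> alg_cong R X E"
| add_assoc: "\<lbrakk>t \<in> alg_terms R X; u \<in> alg_terms R X; v \<in> alg_terms R X\<rbrakk> \<Longrightarrow>
    (Add (Add t u) v, Add t (Add u v)) \<in> alg_cong R X E"
| add_comm: "\<lbrakk>t \<in> alg_terms R X; u \<in> alg_terms R X\<rbrakk> \<Longrightarrow> (Add t u, Add u t) \<in> alg_cong R X E"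
| add_zero: "t \<in> alg_terms R X \<Longrightarrow> (Add Zero t, t) \<in> alg_cong R X E"
| add_neg: "t \<in> alg_terms R X \<Longrightarrow> (Add (Neg t) t, Zero) \<in> alg_cong R X E"
| mul_assoc: "\<lbrakk>t \<in> alg_terms R X; u \<in> alg_terms R X; v \<in> alg_terms R X\<rbrakk> \<Longrightarrow>
    (Mul (Mul t u) v, Mul t (Mul u v)) \<in> alg_cong R X E"
| mul_comm: "\<lbrakk>t \<in> alg_terms R X; u \<in> alg_terms R X\<rbrakk> \<Longrightarrow> (Mul t u, Mul u t) \<in> alg_cong R X E"
| mul_distr: "\<lbrakk>t \<in> alg_terms R X; u \<in> alg_terms R X; v \<in> alg_terms R X\<rbrakk> \<Longrightarrow>
    (Mul (Add t u) v, Add (Mul t v) (Mul u v)) \<in> alg_cong R X E"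
| scal_one: "t \<in> alg_terms R X \<Longrightarrow> (Scal \<one>\<^bsub>R\<^esub> t, t) \<in> alg_cong R X E"
| scal_assoc: "\<lbrakk>a \<in> carrier R; b \<in> carrier R; t \<in> alg_terms R X\<rbrakk> \<Longrightarrow>
    (Scal (a \<otimes>\<^bsub>R\<^esub> b) t, Scal a (Scal b t)) \<in> alg_cong R X E"
| scal_l_distr: "\<lbrakk>a \<in> carrier R; b \<in> carrier R; t \<in> alg_terms R X\<rbrakk> \<Longrightarrow>
    (Scal (a \<oplus>\<^bsub>R\<^esub> b) t, Add (Scal a t) (Scal b t)) \<in> alg_cong R X E"
| scal_r_distr: "\<lbrakk>a \<in> carrier R; t \<in> alg_terms R X; u \<in> alg_terms R X\<rbrakk> \<Longrightarrow>
    (Scal a (Add t u), Add (Scal a t) (Scal a u)) \<in> alg_cong R X E"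
| scal_mul: "\<lbrakk>a \<in> carrier R; t \<in> alg_terms R X; u \<in> alg_terms R X\<rbrakk> \<Longrightarrow>
    (Mul (Scal a t) u, Scal a (Mul t u)) \<in> alg_cong R X E"

definition presented_algebra ::
  "('c, 'z) ring_scheme \<Rightarrow> 'g set \<Rightarrow> (('c, 'g) alg_term \<times> ('c, 'g) alg_term) set \<Rightarrow>
   ('c, ('c, 'g) alg_term set) module" where
  "presented_algebra R X E =
     \<lparr>carrier = alg_terms R X // alg_cong R X E,
      monoid.mult = (\<lambda>U V. \<Union>t\<in>U. \<Union>u\<in>V. alg_cong R X E `` {Mul t u}),
      one = undefined,
      zero = alg_cong R X E `` {Zero},
      add = (\<lambda>U V. \<Union>t\<in>U. \<Union>u\<in>V. alg_cong R X E `` {Add t u}),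
      smult = (\<lambda>a U. \<Union>t\<in>U. alg_cong R X E `` {Scal a t})\<rparr>"

text \<open>An \<open>R\<close>-algebra regarded as a \<open>K\<close>-algebra, where \<open>R\<close> is a \<open>K\<close>-algebra with identity.\<close>

definition restrict_scalars :: "('k, 'r) module \<Rightarrow> ('r, 'a) module \<Rightarrow> ('k, 'a) module" where
  "restrict_scalars R A =
     \<lparr>carrier = carrier A, monoid.mult = monoid.mult A, one = one A, zero = zero A, add = add A,
      smult = (\<lambda>c x. (c \<odot>\<^bsub>R\<^esub> \<one>\<^bsub>R\<^esub>) \<odot>\<^bsub>A\<^esub> x)\<rparr>"


section \<open>The algebras of the induced 2-crossed module\<close>

text \<open>
  In the following, \<open>A\<close> is an \<open>S\<close>-algebra with action \<open>act\<close> and \<open>phi\<close> maps \<open>S\<close> to \<open>R\<close>.  The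
  generator \<open>(d, r)\<close> stands for the tensor \<open>d \<otimes> r\<close>.

  The algebras are generated as \<open>R\<close>-algebras, where \<open>R\<close> acts by \<open>r \<cdot> (d, r1) = (d, r r1)\<close>; this is
  \<open>act_rels\<close>.  It entails \<open>(d, r + r') = (d, r) + (d, r')\<close>, which fails in general in the
  \<open>K\<close>-algebra defined by the remaining relations, so that the formula would then define no action.

  As \<open>S\<close> need not have an identity, the elements of \<open>K\<close> have to be moved across as those of \<open>S\<close>
  are; this is \<open>scalar_rels\<close>.  If \<open>S\<close> has an identity, this follows from \<open>balance_rels\<close>: see
  \<open>scalar_rels_redundant\<close>.
\<close>

definition act_rels ::
  "('k, 'r) module \<Rightarrow> ('k, 'a) module \<Rightarrow> (('r, 'a \<times> 'r) alg_term \<times> ('r, 'a \<times> 'r) alg_term) set" where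
  "act_rels R A = {(Scal r (Gen (d, r1)), Gen (d, r \<otimes>\<^bsub>R\<^esub> r1)) | r d r1.
     r \<in> carrier R \<and> d \<in> carrier A \<and> r1 \<in> carrier R}"

definition scalar_rels ::
  "'k ring \<Rightarrow> ('k, 'r) module \<Rightarrow> ('k, 'a) module \<Rightarrow>
   (('r, 'a \<times> 'r) alg_term \<times> ('r, 'a \<times> 'r) alg_term) set" where
  "scalar_rels K R A = {(Gen (c \<odot>\<^bsub>A\<^esub> d, r), Gen (d, c \<odot>\<^bsub>R\<^esub> r)) | c d r.
     c \<in> carrier K \<and> d \<in> carrier A \<and> r \<in> carrier R}"

definition mult_rels ::
  "('k, 'r) module \<Rightarrow> ('k, 'a) module \<Rightarrow> (('r, 'a \<times> 'r) alg_term \<times> ('r, 'a \<times> 'r) alg_term) set" where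
  "mult_rels R A =
     {(Mul (Gen (d, r)) (Gen (d', r')), Gen (d \<otimes>\<^bsub>A\<^esub> d', r \<otimes>\<^bsub>R\<^esub> r')) | d r d' r'.
        d \<in> carrier A \<and> d' \<in> carrier A \<and> r \<in> carrier R \<and> r' \<in> carrier R}"

definition diff_rels ::
  "('k, 'r) module \<Rightarrow> ('k, 'a) module \<Rightarrow> (('r, 'a \<times> 'r) alg_term \<times> ('r, 'a \<times> 'r) alg_term) set" where
  "diff_rels R A =
     {(Add (Gen (d, r)) (Neg (Gen (d', r))), Gen (d \<ominus>\<^bsub>A\<^esub> d', r)) | d d' r.
        d \<in> carrier A \<and> d' \<in> carrier A \<and> r \<in> carrier R}"

definition sum_rels ::
  "('k, 'r) module \<Rightarrow> ('k, 'a) module \<Rightarrow> (('r, 'a \<times> 'r) alg_term \<times> ('r, 'a \<times> 'r) alg_term) set" where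
  "sum_rels R A =
     {(Add (Gen (d, r)) (Gen (d', r)), Gen (d \<oplus>\<^bsub>A\<^esub> d', r)) | d d' r.
        d \<in> carrier A \<and> d' \<in> carrier A \<and> r \<in> carrier R}"

definition balance_rels ::
  "('k, 's) module \<Rightarrow> ('k, 'r) module \<Rightarrow> ('k, 'a) module \<Rightarrow> ('s \<Rightarrow> 'r) \<Rightarrow> ('s \<Rightarrow> 'a \<Rightarrow> 'a) \<Rightarrow>
   (('r, 'a \<times> 'r) alg_term \<times> ('r, 'a \<times> 'r) alg_term) set" where
  "balance_rels S R A phi act = {(Gen (act s d, r), Gen (d, phi s \<otimes>\<^bsub>R\<^esub> r)) | s d r.
     s \<in> carrier S \<and> d \<in> carrier A \<and> r \<in> carrier R}"

lemma scalar_rels_redundant: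
  assumes "algebra K R" "comm_alg K S" "comm_alg K A"
    and phi: "alg_hom K S R phi" and act: "alg_action K S A act"
    and e: "is_identity S e" and unital: "\<And>d. d \<in> carrier A \<Longrightarrow> act e d = d"
    and E: "balance_rels S R A phi act \<subseteq> E"
  shows "scalar_rels K R A \<subseteq> alg_cong R (carrier A \<times> carrier R) E"
proof -
  interpret R: algebra K R by fact
  interpret S: comm_alg K S by fact
  interpret A: comm_alg K A by fact
  let ?C = "alg_cong R (carrier A \<times> carrier R) E"
  have eS: "e \<in> carrier S" using e by (simp add: is_identity_def)
  have bal: "(Gen (act s d, r), Gen (d, phi s \<otimes>\<^bsub>R\<^esub> r)) \<in> ?C"
    if "s \<in> carrier S" "d \<in> carrier A" "r \<in> carrier R" for s d r
  proof (rule alg_cong.rel)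
    show "(Gen (act s d, r), Gen (d, phi s \<otimes>\<^bsub>R\<^esub> r)) \<in> E"
      using E that by (auto simp: balance_rels_def)
    have "act s d \<in> carrier A" "phi s \<in> carrier R"
      using act phi that by (auto simp: alg_action_def bilinear_map_def alg_hom_def)
    with that show "Gen (act s d, r) \<in> alg_terms R (carrier A \<times> carrier R)"
      "Gen (d, phi s \<otimes>\<^bsub>R\<^esub> r) \<in> alg_terms R (carrier A \<times> carrier R)"
      by (auto intro!: alg_terms.Gen)
  qed
  have "(Gen (c \<odot>\<^bsub>A\<^esub> d, r), Gen (d, c \<odot>\<^bsub>R\<^esub> r)) \<in> ?C"
    if c: "c \<in> carrier K" and d: "d \<in> carrier A" and r: "r \<in> carrier R" for c d r
  proof -
    have pe: "phi e \<in> carrier R" using phi eS by (auto simp: alg_hom_def)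
    have ce: "c \<odot>\<^bsub>S\<^esub> e \<in> carrier S" using c eS by simp
    have 1: "act (c \<odot>\<^bsub>S\<^esub> e) d = c \<odot>\<^bsub>A\<^esub> d"
      using act c d eS unital[OF d] by (simp add: alg_action_def bilinear_map_def)
    have "phi (c \<odot>\<^bsub>S\<^esub> e) \<otimes>\<^bsub>R\<^esub> r = (c \<odot>\<^bsub>R\<^esub> phi e) \<otimes>\<^bsub>R\<^esub> r"
      using phi c eS by (simp add: alg_hom_def)
    also have "\<dots> = phi e \<otimes>\<^bsub>R\<^esub> (c \<odot>\<^bsub>R\<^esub> r)"
      using c r pe by (metis R.smult_assoc2 R.m_comm R.smult_closed)
    finally have 2: "phi (c \<odot>\<^bsub>S\<^esub> e) \<otimes>\<^bsub>R\<^esub> r = phi e \<otimes>\<^bsub>R\<^esub> (c \<odot>\<^bsub>R\<^esub> r)" .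
    have "(Gen (c \<odot>\<^bsub>A\<^esub> d, r), Gen (d, phi e \<otimes>\<^bsub>R\<^esub> (c \<odot>\<^bsub>R\<^esub> r))) \<in> ?C"
      using bal[OF ce d r] 1 2 by simp
    moreover have "(Gen (d, c \<odot>\<^bsub>R\<^esub> r), Gen (d, phi e \<otimes>\<^bsub>R\<^esub> (c \<odot>\<^bsub>R\<^esub> r))) \<in> ?C"
      using bal[OF eS d, of "c \<odot>\<^bsub>R\<^esub> r"] c r unital[OF d] by simp
    ultimately show ?thesis
      by (meson alg_cong.sym alg_cong.trans)
  qed
  then show ?thesis by (auto simp: scalar_rels_def)
qed

definition mid_rels ::
  "'k ring \<Rightarrow> ('k, 'r) module \<Rightarrow> ('k, 'l, 'm, 's) two_crossed \<Rightarrow> ('s \<Rightarrow> 'r) \<Rightarrow>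
   (('r, 'm \<times> 'r) alg_term \<times> ('r, 'm \<times> 'r) alg_term) set" where
  "mid_rels K R D phi =
     mult_rels R (mid_alg D) \<union> diff_rels R (mid_alg D) \<union>
     balance_rels (base_alg D) R (mid_alg D) phi (act_mid D) \<union>
     act_rels R (mid_alg D) \<union> scalar_rels K R (mid_alg D)"

definition mid_algR ::
  "'k ring \<Rightarrow> ('k, 'r) module \<Rightarrow> ('k, 'l, 'm, 's) two_crossed \<Rightarrow> ('s \<Rightarrow> 'r) \<Rightarrow>
   ('r, ('r, 'm \<times> 'r) alg_term set) module" where
  "mid_algR K R D phi =
     presented_algebra R (carrier (mid_alg D) \<times> carrier R) (mid_rels K R D phi)"

definition mid_gen ::
  "'k ring \<Rightarrow> ('k, 'r) module \<Rightarrow> ('k, 'l, 'm, 's) two_crossed \<Rightarrow> ('s \<Rightarrow> 'r) \<Rightarrow>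
   'm \<Rightarrow> 'r \<Rightarrow> ('r, 'm \<times> 'r) alg_term set" where
  "mid_gen K R D phi d r =
     alg_cong R (carrier (mid_alg D) \<times> carrier R) (mid_rels K R D phi) `` {Gen (d, r)}"

text \<open>
  Biadditivity of the Peiffer lifting as relations between generators of the top algebra.  The
  bracket of two generators of the middle algebra is the generator \<open>({d, d'}, r r')\<close>, so additivity
  is a condition on generators whenever a sum of two generators is again a generator \<open>(e, q)\<close>; on
  all other sums it says how the bracket is extended, and is then part of the bilinearity of the
  Peiffer lifting.
\<close>

definition lift_rels ::
  "'k ring \<Rightarrow> ('k, 'r) module \<Rightarrow> ('k, 'l, 'm, 's) two_crossed \<Rightarrow> ('s \<Rightarrow> 'r) \<Rightarrow>
   (('r, 'l \<times> 'r) alg_term \<times> ('r, 'l \<times> 'r) alg_term) set" where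
  "lift_rels K R D phi =
     {(Gen (lifting D e d'', q \<otimes>\<^bsub>R\<^esub> r''),
       Add (Gen (lifting D d d'', r \<otimes>\<^bsub>R\<^esub> r'')) (Gen (lifting D d' d'', r' \<otimes>\<^bsub>R\<^esub> r'')))
      | e q d r d' r' d'' r''.
        {e, d, d', d''} \<subseteq> carrier (mid_alg D) \<and> {q, r, r', r''} \<subseteq> carrier R \<and>
        mid_gen K R D phi e q =
          mid_gen K R D phi d r \<oplus>\<^bsub>mid_algR K R D phi\<^esub> mid_gen K R D phi d' r'} \<union>
     {(Gen (lifting D d e, r \<otimes>\<^bsub>R\<^esub> q),
       Add (Gen (lifting D d d', r \<otimes>\<^bsub>R\<^esub> r')) (Gen (lifting D d d'', r \<otimes>\<^bsub>R\<^esub> r'')))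
      | e q d r d' r' d'' r''.
        {e, d, d', d''} \<subseteq> carrier (mid_alg D) \<and> {q, r, r', r''} \<subseteq> carrier R \<and>
        mid_gen K R D phi e q =
          mid_gen K R D phi d' r' \<oplus>\<^bsub>mid_algR K R D phi\<^esub> mid_gen K R D phi d'' r''}"

definition top_rels ::
  "'k ring \<Rightarrow> ('k, 'r) module \<Rightarrow> ('k, 'l, 'm, 's) two_crossed \<Rightarrow> ('s \<Rightarrow> 'r) \<Rightarrow>
   (('r, 'l \<times> 'r) alg_term \<times> ('r, 'l \<times> 'r) alg_term) set" where
  "top_rels K R D phi =
     lift_rels K R D phi \<union> mult_rels R (top_alg D) \<union> sum_rels R (top_alg D) \<union>
     balance_rels (base_alg D) R (top_alg D) phi (act_top D) \<union>
     act_rels R (top_alg D) \<union> scalar_rels K R (top_alg D)"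

definition top_algR ::
  "'k ring \<Rightarrow> ('k, 'r) module \<Rightarrow> ('k, 'l, 'm, 's) two_crossed \<Rightarrow> ('s \<Rightarrow> 'r) \<Rightarrow>
   ('r, ('r, 'l \<times> 'r) alg_term set) module" where
  "top_algR K R D phi =
     presented_algebra R (carrier (top_alg D) \<times> carrier R) (top_rels K R D phi)"

definition top_gen ::
  "'k ring \<Rightarrow> ('k, 'r) module \<Rightarrow> ('k, 'l, 'm, 's) two_crossed \<Rightarrow> ('s \<Rightarrow> 'r) \<Rightarrow>
   'l \<Rightarrow> 'r \<Rightarrow> ('r, 'l \<times> 'r) alg_term set" where
  "top_gen K R D phi d r =
     alg_cong R (carrier (top_alg D) \<times> carrier R) (top_rels K R D phi) `` {Gen (d, r)}"

text \<open>
  The last condition is the action of the middle algebra on the top one, \<open>x \<cdot> y = {x, \<partial>y}\<close>; the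
  second component is \<open>r1 r2\<close>, since an element independent of \<open>r1\<close> would not be additive in
  \<open>(d1, r1)\<close>.
\<close>

definition presented_two_crossed ::
  "'k ring \<Rightarrow> ('k, 'r) module \<Rightarrow> ('k, 'l, 'm, 's) two_crossed \<Rightarrow> ('s \<Rightarrow> 'r) \<Rightarrow>
   ('k, ('r, 'l \<times> 'r) alg_term set, ('r, 'm \<times> 'r) alg_term set, 'r) two_crossed \<Rightarrow> bool" where
  "presented_two_crossed K R D phi I \<longleftrightarrow>
     top_alg I = restrict_scalars R (top_algR K R D phi) \<and>
     mid_alg I = restrict_scalars R (mid_algR K R D phi) \<and>
     base_alg I = R \<and>
     (\<forall>d2\<in>carrier (top_alg D). \<forall>r\<in>carrier R.
        bdry2 I (top_gen K R D phi d2 r) = mid_gen K R D phi (bdry2 D d2) r) \<and>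
     (\<forall>d1\<in>carrier (mid_alg D). \<forall>r\<in>carrier R.
        bdry1 I (mid_gen K R D phi d1 r) = phi (bdry1 D d1) \<otimes>\<^bsub>R\<^esub> r) \<and>
     (\<forall>r\<in>carrier R. \<forall>d1\<in>carrier (mid_alg D). \<forall>r1\<in>carrier R.
        act_mid I r (mid_gen K R D phi d1 r1) = mid_gen K R D phi d1 (r \<otimes>\<^bsub>R\<^esub> r1)) \<and>
     (\<forall>r\<in>carrier R. \<forall>d2\<in>carrier (top_alg D). \<forall>r'\<in>carrier R.
        act_top I r (top_gen K R D phi d2 r') = top_gen K R D phi d2 (r \<otimes>\<^bsub>R\<^esub> r')) \<and>
     (\<forall>d1\<in>carrier (mid_alg D). \<forall>r1\<in>carrier R. \<forall>d1'\<in>carrier (mid_alg D). \<forall>r1'\<in>carrier R.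
        lifting I (mid_gen K R D phi d1 r1) (mid_gen K R D phi d1' r1') =
          top_gen K R D phi (lifting D d1 d1') (r1 \<otimes>\<^bsub>R\<^esub> r1')) \<and>
     (\<forall>d1\<in>carrier (mid_alg D). \<forall>r1\<in>carrier R. \<forall>d2\<in>carrier (top_alg D). \<forall>r2\<in>carrier R.
        lifting I (mid_gen K R D phi d1 r1) (bdry2 I (top_gen K R D phi d2 r2)) =
          top_gen K R D phi (lifting D d1 (bdry2 D d2)) (r1 \<otimes>\<^bsub>R\<^esub> r2))"

end

theory Submission
  imports Defs
begin

text \<open>
  As an \<open>R\<close>-module, the algebra with generators \<open>(d, r)\<close> and the given relations is the base change
  \<open>D \<otimes> R\<close>: the \<open>R\<close>-linear maps from it to an \<open>R\<close>-module \<open>N\<close> are the same as the maps \<open>u : D \<rightarrow> N\<close> that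
  are semilinear along \<open>phi\<close>.  To extend \<open>u\<close>, one evaluates terms by \<open>(d, r) \<mapsto> r u(d)\<close>, expanding
  products of sums of generators, and checks by induction, for all \<open>u\<close> at once, that congruent terms
  have equal values.  Since the algebra is spanned additively by its generators, every identity
  between additive maps (the axioms of a 2-crossed module, compatibility with a morphism, uniqueness)
  can then be checked on generators.
\<close>

section \<open>Presented algebras\<close>

text \<open>An algebra given by generators and relations is usually mapped into another algebra by a
  homomorphism respecting the relations. That would give the boundaries but not the Peiffer lifting:
  with one argument fixed, the lifting is linear but in general not multiplicative, so it must be
  defined on terms containing \<open>Mul\<close> with values in a mere \<open>R\<close>-module. The
  value of \<open>u\<close> on a product is therefore read off the map
  \<open>(d, d') |-> u (d d')\<close>. This replaces \<open>u\<close> by another map under every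
  \<open>Mul\<close>, which is why no single \<open>u\<close> can be treated alone, and why
  commutativity of the product becomes an exchange of two finite sums.

  The relations \<open>lift_rels\<close> refer to sums in the middle algebra and look as if they
  could shrink the top algebra. They cannot, since the lifting already exists on the base change
  without them. Both algebras are thus instances of one construction, with the relations
  \<open>base_change_rels\<close>.

  The structure maps are prescribed on generators only. The universal property is therefore proved
  for every 2-crossed module with these values, and \<open>base_changed\<close> provides
  one.\<close>

locale presentation = cring R for R :: "('c, 'z) ring_scheme" +
  fixes X :: "'g set" and E :: "(('c, 'g) alg_term \<times> ('c, 'g) alg_term) set"
begin

abbreviation T where "T \<equiv> alg_terms R X"
abbreviation C where "C \<equiv> alg_cong R X E"
abbreviation A where "A \<equiv> presented_algebra R X E"
abbreviation cls where "cls t \<equiv> C `` {t}"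

lemma cong_terms:
  assumes "(t, u) \<in> C"
  shows "t \<in> T \<and> u \<in> T"
  using assms by induction (auto intro: alg_terms.intros)

lemma equiv_cong: "equiv T C"
  using cong_terms
  by (intro equivI) (auto simp: refl_on_def sym_def trans_def intro: alg_cong.refl alg_cong.sym alg_cong.trans)

lemma cls_eq_iff: "\<lbrakk>t \<in> T; u \<in> T\<rbrakk> \<Longrightarrow> cls t = cls u \<longleftrightarrow> (t, u) \<in> C"
  using equiv_class_eq_iff[OF equiv_cong] by blast

lemma cls_eqI: "(t, u) \<in> C \<Longrightarrow> cls t = cls u"
  using equiv_class_eq[OF equiv_cong] .

lemma carrier_A: "carrier A = cls ` T"
  by (auto simp: presented_algebra_def quotient_def)

lemma cls_closed [simp, intro]: "t \<in> T \<Longrightarrow> cls t \<in> carrier A"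
  by (simp add: carrier_A)

lemma cls_cases:
  assumes "x \<in> carrier A"
  obtains t where "t \<in> T" "x = cls t"
  using assms by (auto simp: carrier_A)

lemma zero_cls: "\<zero>\<^bsub>A\<^esub> = cls Zero"
  by (simp add: presented_algebra_def)

lemma add_cls: "\<lbrakk>t \<in> T; u \<in> T\<rbrakk> \<Longrightarrow> cls t \<oplus>\<^bsub>A\<^esub> cls u = cls (Add t u)"
  using UN_equiv_class2[OF equiv_cong equiv_cong, of "\<lambda>t u. cls (Add t u)" t u]
  by (auto simp: presented_algebra_def congruent2_def intro!: cls_eqI alg_cong.add_cong)

lemma mult_cls: "\<lbrakk>t \<in> T; u \<in> T\<rbrakk> \<Longrightarrow> cls t \<otimes>\<^bsub>A\<^esub> cls u = cls (Mul t u)"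
  using UN_equiv_class2[OF equiv_cong equiv_cong, of "\<lambda>t u. cls (Mul t u)" t u]
  by (auto simp: presented_algebra_def congruent2_def intro!: cls_eqI alg_cong.mul_cong)

lemma smult_cls: "\<lbrakk>a \<in> carrier R; t \<in> T\<rbrakk> \<Longrightarrow> a \<odot>\<^bsub>A\<^esub> cls t = cls (Scal a t)"
  using UN_equiv_class[OF equiv_cong, of "\<lambda>t. cls (Scal a t)" t]
  by (auto simp: presented_algebra_def congruent_def intro!: cls_eqI alg_cong.scal_cong)

lemmas cls_ops = zero_cls add_cls mult_cls smult_cls
lemmas term_intros = alg_terms.intros

text \<open>Elements are classes, so each axiom is an equation between sets.
  \<open>cls_eq_iff\<close> turns it into a congruence, which is a rule of \<open>alg_cong\<close>;
  \<open>equalityI\<close> is withheld here and below because it would split the equation into two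
  inclusions.\<close>

lemma abelian_group_A: "abelian_group A"
proof (rule abelian_groupI)
  fix x assume "x \<in> carrier A"
  then obtain t where "t \<in> T" "x = cls t" by (rule cls_cases)
  then show "\<exists>y\<in>carrier A. y \<oplus>\<^bsub>A\<^esub> x = \<zero>\<^bsub>A\<^esub>"
    by (intro bexI[of _ "cls (Neg t)"])
      (auto del: equalityI simp: cls_ops cls_eq_iff term_intros intro: alg_cong.add_neg)
qed (auto del: equalityI elim!: cls_cases simp: cls_ops cls_eq_iff term_intros
    intro: alg_cong.add_assoc alg_cong.add_comm alg_cong.add_zero)

lemma module_A: "module R A"
  by (rule moduleI)
    (auto del: equalityI elim!: cls_cases simp: cls_ops cls_eq_iff term_intros abelian_group_A is_cring
      intro: alg_cong.scal_l_distr alg_cong.scal_r_distr alg_cong.scal_assoc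
        alg_cong.scal_one)

sublocale A: module R A
  by (rule module_A)

lemma mult_closed_A [simp, intro]: "\<lbrakk>x \<in> carrier A; y \<in> carrier A\<rbrakk> \<Longrightarrow> x \<otimes>\<^bsub>A\<^esub> y \<in> carrier A"
  by (auto del: equalityI elim!: cls_cases simp: cls_ops cls_eq_iff term_intros)

lemma mult_assoc_A: "\<lbrakk>x \<in> carrier A; y \<in> carrier A; z \<in> carrier A\<rbrakk> \<Longrightarrow>
    (x \<otimes>\<^bsub>A\<^esub> y) \<otimes>\<^bsub>A\<^esub> z = x \<otimes>\<^bsub>A\<^esub> (y \<otimes>\<^bsub>A\<^esub> z)"
  by (auto del: equalityI elim!: cls_cases simp: cls_ops cls_eq_iff term_intros intro: alg_cong.mul_assoc)

lemma mult_comm_A: "\<lbrakk>x \<in> carrier A; y \<in> carrier A\<rbrakk> \<Longrightarrow> x \<otimes>\<^bsub>A\<^esub> y = y \<otimes>\<^bsub>A\<^esub> x"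
  by (auto del: equalityI elim!: cls_cases simp: cls_ops cls_eq_iff term_intros intro: alg_cong.mul_comm)

lemma mult_distr_A: "\<lbrakk>x \<in> carrier A; y \<in> carrier A; z \<in> carrier A\<rbrakk> \<Longrightarrow>
    (x \<oplus>\<^bsub>A\<^esub> y) \<otimes>\<^bsub>A\<^esub> z = x \<otimes>\<^bsub>A\<^esub> z \<oplus>\<^bsub>A\<^esub> y \<otimes>\<^bsub>A\<^esub> z"
  by (auto del: equalityI elim!: cls_cases simp: cls_ops cls_eq_iff term_intros intro: alg_cong.mul_distr)

lemma mult_distr_right_A:
  "\<lbrakk>x \<in> carrier A; y \<in> carrier A; z \<in> carrier A\<rbrakk> \<Longrightarrow>
    z \<otimes>\<^bsub>A\<^esub> (x \<oplus>\<^bsub>A\<^esub> y) = z \<otimes>\<^bsub>A\<^esub> x \<oplus>\<^bsub>A\<^esub> z \<otimes>\<^bsub>A\<^esub> y"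
  using mult_distr_A[of x y z] by (simp add: mult_comm_A)

lemma smult_mult_A: "\<lbrakk>a \<in> carrier R; x \<in> carrier A; y \<in> carrier A\<rbrakk> \<Longrightarrow>
    (a \<odot>\<^bsub>A\<^esub> x) \<otimes>\<^bsub>A\<^esub> y = a \<odot>\<^bsub>A\<^esub> (x \<otimes>\<^bsub>A\<^esub> y)"
  by (auto del: equalityI elim!: cls_cases simp: cls_ops cls_eq_iff term_intros intro: alg_cong.scal_mul)

lemma neg_cls:
  assumes "t \<in> T"
  shows "\<ominus>\<^bsub>A\<^esub> cls t = cls (Neg t)"
proof (rule A.M.minus_equality)
  show "cls (Neg t) \<oplus>\<^bsub>A\<^esub> cls t = \<zero>\<^bsub>A\<^esub>"
    using assms by (auto del: equalityI simp: cls_ops cls_eq_iff term_intros intro: alg_cong.add_neg)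
qed (use assms in \<open>auto intro: term_intros\<close>)

end

text \<open>All rules of \<open>alg_cong\<close> except \<open>rel\<close> are common to both
  congruences, so only the relations themselves have to be derived. This is how two presentations
  are shown to define the same algebra.\<close>

lemma alg_cong_least:
  assumes E: "\<And>t u. \<lbrakk>(t, u) \<in> E; t \<in> alg_terms R X; u \<in> alg_terms R X\<rbrakk> \<Longrightarrow> (t, u) \<in> alg_cong R X E'"
  shows "alg_cong R X E \<subseteq> alg_cong R X E'"
proof
  fix p assume "p \<in> alg_cong R X E"
  then have "(fst p, snd p) \<in> alg_cong R X E" by simp
  then have "(fst p, snd p) \<in> alg_cong R X E'"
    by induction (auto intro: alg_cong.intros E)
  then show "p \<in> alg_cong R X E'" by simp
qed

lemma presented_algebra_cong:
  "alg_cong R X E = alg_cong R X E' \<Longrightarrow> presented_algebra R X E = presented_algebra R X E'"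
  by (simp add: presented_algebra_def)

text \<open>Only carriers and addition enter, so the notion is unaffected by
  \<open>restrict_scalars\<close> and \<open>with_smult\<close>. Additivity is enough to compare
  maps on generators because scalar multiples and products of generators are again
  generators.\<close>

definition additive_map :: "('a, 'y) ring_scheme \<Rightarrow> ('b, 'z) ring_scheme \<Rightarrow> ('a \<Rightarrow> 'b) \<Rightarrow> bool" where
  "additive_map G H F \<longleftrightarrow> F \<in> carrier G \<rightarrow> carrier H \<and>
     (\<forall>x\<in>carrier G. \<forall>y\<in>carrier G. F (x \<oplus>\<^bsub>G\<^esub> y) = F x \<oplus>\<^bsub>H\<^esub> F y)"

lemma restrict_scalars_simps [simp]:
  "carrier (restrict_scalars R A) = carrier A"
  "monoid.mult (restrict_scalars R A) = monoid.mult A"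
  "zero (restrict_scalars R A) = zero A"
  "add (restrict_scalars R A) = add A"
  "smult (restrict_scalars R A) c x = (c \<odot>\<^bsub>R\<^esub> \<one>\<^bsub>R\<^esub>) \<odot>\<^bsub>A\<^esub> x"
  by (simp_all add: restrict_scalars_def)

lemma restrict_scalars_neg [simp]:
  "a_inv (restrict_scalars R A) = a_inv A"
  "a_minus (restrict_scalars R A) = a_minus A"
  by (auto simp: restrict_scalars_def a_inv_def a_minus_def m_inv_def fun_eq_iff)

text \<open>Changes the scalars from \<open>K\<close> to \<open>R\<close>. It is applied to the
  algebras of a 2-crossed module over \<open>R\<close>, with the action as scalar multiplication,
  and to \<open>R\<close> itself with its own product.\<close>

definition with_smult :: "('k, 'a) module \<Rightarrow> ('r \<Rightarrow> 'a \<Rightarrow> 'a) \<Rightarrow> ('r, 'a) module" where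
  "with_smult A f = \<lparr>carrier = carrier A, monoid.mult = monoid.mult A, one = one A, zero = zero A,
     add = add A, smult = f\<rparr>"

lemma with_smult_simps [simp]:
  "carrier (with_smult A f) = carrier A"
  "monoid.mult (with_smult A f) = monoid.mult A"
  "zero (with_smult A f) = zero A"
  "add (with_smult A f) = add A"
  "smult (with_smult A f) = f"
  by (simp_all add: with_smult_def)

lemma abelian_group_with_smult:
  assumes "abelian_group A"
  shows "abelian_group (with_smult A f)"
proof -
  interpret abelian_group A by fact
  show ?thesis
    by (rule abelian_groupI) (auto simp: a_ac intro: bexI[where x = "\<ominus>\<^bsub>A\<^esub> x" for x] l_neg)
qed

lemma algebra_comm_alg:
  assumes "algebra K R"
  shows "comm_alg K R"
proof -
  interpret A: cring R using assms by (rule algebra.M_cring)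
  show ?thesis
    by (intro comm_alg.intro algebra.module[OF assms] comm_alg_axioms.intro)
      (simp_all add: A.m_assoc A.l_distr algebra.smult_assoc2[OF assms], rule A.m_comm)
qed

lemma alg_hom_zero:
  assumes "comm_alg K G" "comm_alg K H" "alg_hom K G H f"
  shows "f \<zero>\<^bsub>G\<^esub> = \<zero>\<^bsub>H\<^esub>"
proof -
  interpret G: comm_alg K G by fact
  interpret H: comm_alg K H by fact
  have "f (\<zero>\<^bsub>K\<^esub> \<odot>\<^bsub>G\<^esub> \<zero>\<^bsub>G\<^esub>) = \<zero>\<^bsub>K\<^esub> \<odot>\<^bsub>H\<^esub> f \<zero>\<^bsub>G\<^esub>" "f \<zero>\<^bsub>G\<^esub> \<in> carrier H"
    using assms(3) G.M.zero_closed G.R.zero_closed unfolding alg_hom_def by blast+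
  then show ?thesis by simp
qed

lemma alg_hom_additive: "alg_hom K G H f \<Longrightarrow> additive_map G H f"
  by (simp add: alg_hom_def additive_map_def)

section \<open>Base change of an algebra\<close>

text \<open>One set of relations for both algebras: by \<open>cong_diff_rels\<close> it generates
  the same congruence as \<open>mid_rels\<close>, and by \<open>alg_cong_top\<close> the same as
  \<open>top_rels\<close>.\<close>

definition base_change_rels ::
  "'k ring \<Rightarrow> ('k, 's) module \<Rightarrow> ('k, 'r) module \<Rightarrow> ('k, 'a) module \<Rightarrow> ('s \<Rightarrow> 'r) \<Rightarrow> ('s \<Rightarrow> 'a \<Rightarrow> 'a) \<Rightarrow>
   (('r, 'a \<times> 'r) alg_term \<times> ('r, 'a \<times> 'r) alg_term) set" where
  "base_change_rels K S R A phi act =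
     mult_rels R A \<union> sum_rels R A \<union> balance_rels S R A phi act \<union> act_rels R A \<union> scalar_rels K R A"

text \<open>If \<open>t\<close> and \<open>t'\<close> stand for sums of generators
  \<open>(d_i, r_i)\<close> and \<open>(e_j, q_j)\<close>, the clause for \<open>Mul\<close> yields
  the sum of all \<open>r_i q_j u(d_i e_j)\<close>, without a product in \<open>N\<close>. The
  argument \<open>m\<close> is the product of the algebra being extended.\<close>

primrec eval_term ::
  "('r, 'n) module \<Rightarrow> ('a \<Rightarrow> 'a \<Rightarrow> 'a) \<Rightarrow> ('a \<Rightarrow> 'n) \<Rightarrow> ('r, 'a \<times> 'r) alg_term \<Rightarrow> 'n" where
  "eval_term N m u (Gen g) = snd g \<odot>\<^bsub>N\<^esub> u (fst g)"
| "eval_term N m u Zero = \<zero>\<^bsub>N\<^esub>"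
| "eval_term N m u (Neg t) = \<ominus>\<^bsub>N\<^esub> eval_term N m u t"
| "eval_term N m u (Add t t') = eval_term N m u t \<oplus>\<^bsub>N\<^esub> eval_term N m u t'"
| "eval_term N m u (Mul t t') = eval_term N m (\<lambda>d. eval_term N m (\<lambda>d'. u (m d d')) t') t"
| "eval_term N m u (Scal a t) = a \<odot>\<^bsub>N\<^esub> eval_term N m u t"

locale base_change = R: algebra K R + S: comm_alg K S + B: comm_alg K B
  for K :: "'k ring" and R :: "('k, 'r) module" and S :: "('k, 's) module" and B :: "('k, 'a) module" +
  fixes phi :: "'s \<Rightarrow> 'r" and act :: "'s \<Rightarrow> 'a \<Rightarrow> 'a"
  assumes phi_hom: "alg_hom K S R phi"
    and action: "alg_action K S B act"
begin

lemma phi_closed [simp, intro]: "s \<in> carrier S \<Longrightarrow> phi s \<in> carrier R"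
  using phi_hom by (auto simp: alg_hom_def)

lemma act_closed [simp, intro]: "\<lbrakk>s \<in> carrier S; d \<in> carrier B\<rbrakk> \<Longrightarrow> act s d \<in> carrier B"
  using action by (auto simp: alg_action_def bilinear_map_def)

lemma act_mult_left:
  "\<lbrakk>s \<in> carrier S; d \<in> carrier B; d' \<in> carrier B\<rbrakk> \<Longrightarrow> act s d \<otimes>\<^bsub>B\<^esub> d' = act s (d \<otimes>\<^bsub>B\<^esub> d')"
  using action by (auto simp: alg_action_def)

lemma act_mult_right:
  "\<lbrakk>s \<in> carrier S; d \<in> carrier B; d' \<in> carrier B\<rbrakk> \<Longrightarrow> d \<otimes>\<^bsub>B\<^esub> act s d' = act s (d \<otimes>\<^bsub>B\<^esub> d')"
  using act_mult_left B.mult_comm by auto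

lemma distr_right:
  "\<lbrakk>x \<in> carrier B; y \<in> carrier B; z \<in> carrier B\<rbrakk> \<Longrightarrow> z \<otimes>\<^bsub>B\<^esub> (x \<oplus>\<^bsub>B\<^esub> y) = z \<otimes>\<^bsub>B\<^esub> x \<oplus>\<^bsub>B\<^esub> z \<otimes>\<^bsub>B\<^esub> y"
  using B.mult_distr[of x y z] by (simp add: B.mult_comm)

lemma smult_mult_right:
  "\<lbrakk>c \<in> carrier K; x \<in> carrier B; y \<in> carrier B\<rbrakk> \<Longrightarrow> x \<otimes>\<^bsub>B\<^esub> (c \<odot>\<^bsub>B\<^esub> y) = c \<odot>\<^bsub>B\<^esub> (x \<otimes>\<^bsub>B\<^esub> y)"
  using B.smult_mult[of c y x] by (simp add: B.mult_comm)

declare B.mult_closed [simp, intro]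

abbreviation rels where "rels \<equiv> base_change_rels K S R B phi act"
abbreviation gens where "gens \<equiv> carrier B \<times> carrier R"

sublocale P: presentation R gens rels ..

section \<open>Relations between generators in the quotient, and additive spanning\<close>

definition gen where "gen d r = P.cls (Gen (d, r))"

lemma gen_term [simp, intro]: "\<lbrakk>d \<in> carrier B; r \<in> carrier R\<rbrakk> \<Longrightarrow> Gen (d, r) \<in> P.T"
  by (auto intro: alg_terms.Gen)

lemma gen_closed [simp, intro]: "\<lbrakk>d \<in> carrier B; r \<in> carrier R\<rbrakk> \<Longrightarrow> gen d r \<in> carrier P.A"
  unfolding gen_def by auto

lemma rel_cls: "\<lbrakk>(t, u) \<in> rels; t \<in> P.T; u \<in> P.T\<rbrakk> \<Longrightarrow> P.cls t = P.cls u"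
  by (intro P.cls_eqI alg_cong.rel)

lemma gen_mult:
  assumes "d \<in> carrier B" "d' \<in> carrier B" "r \<in> carrier R" "r' \<in> carrier R"
  shows "gen d r \<otimes>\<^bsub>P.A\<^esub> gen d' r' = gen (d \<otimes>\<^bsub>B\<^esub> d') (r \<otimes>\<^bsub>R\<^esub> r')"
proof -
  have "(Mul (Gen (d, r)) (Gen (d', r')), Gen (d \<otimes>\<^bsub>B\<^esub> d', r \<otimes>\<^bsub>R\<^esub> r')) \<in> rels"
    using assms unfolding base_change_rels_def mult_rels_def by blast
  then show ?thesis
    using assms unfolding gen_def by (simp add: P.cls_ops P.term_intros rel_cls)
qed

lemma gen_add:
  assumes "d \<in> carrier B" "d' \<in> carrier B" "r \<in> carrier R"
  shows "gen (d \<oplus>\<^bsub>B\<^esub> d') r = gen d r \<oplus>\<^bsub>P.A\<^esub> gen d' r"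
proof -
  have "(Add (Gen (d, r)) (Gen (d', r)), Gen (d \<oplus>\<^bsub>B\<^esub> d', r)) \<in> rels"
    using assms unfolding base_change_rels_def sum_rels_def by blast
  then show ?thesis
    using assms unfolding gen_def by (simp add: P.cls_ops P.term_intros rel_cls)
qed

lemma gen_balance:
  assumes "s \<in> carrier S" "d \<in> carrier B" "r \<in> carrier R"
  shows "gen (act s d) r = gen d (phi s \<otimes>\<^bsub>R\<^esub> r)"
proof -
  have "(Gen (act s d, r), Gen (d, phi s \<otimes>\<^bsub>R\<^esub> r)) \<in> rels"
    using assms unfolding base_change_rels_def balance_rels_def by blast
  then show ?thesis
    using assms unfolding gen_def by (simp add: rel_cls)
qed

lemma gen_act:
  assumes "a \<in> carrier R" "d \<in> carrier B" "r \<in> carrier R"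
  shows "a \<odot>\<^bsub>P.A\<^esub> gen d r = gen d (a \<otimes>\<^bsub>R\<^esub> r)"
proof -
  have "(Scal a (Gen (d, r)), Gen (d, a \<otimes>\<^bsub>R\<^esub> r)) \<in> rels"
    using assms unfolding base_change_rels_def act_rels_def by blast
  then show ?thesis
    using assms unfolding gen_def by (simp add: P.cls_ops P.term_intros rel_cls)
qed

lemma gen_scalar:
  assumes "c \<in> carrier K" "d \<in> carrier B" "r \<in> carrier R"
  shows "gen (c \<odot>\<^bsub>B\<^esub> d) r = gen d (c \<odot>\<^bsub>R\<^esub> r)"
proof -
  have "(Gen (c \<odot>\<^bsub>B\<^esub> d, r), Gen (d, c \<odot>\<^bsub>R\<^esub> r)) \<in> rels"
    using assms unfolding base_change_rels_def scalar_rels_def by blast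
  then show ?thesis
    using assms unfolding gen_def by (simp add: rel_cls)
qed

text \<open>Finite sums of generators, lengthened by one generator at a time, so that closure under
  scalars and products reduces to \<open>gen_act\<close> and \<open>gen_mult\<close>. By
  \<open>cls_span\<close> these sums exhaust the algebra.\<close>

inductive_set gen_span where
  zero: "\<zero>\<^bsub>P.A\<^esub> \<in> gen_span"
| add: "\<lbrakk>d \<in> carrier B; r \<in> carrier R; x \<in> gen_span\<rbrakk> \<Longrightarrow> gen d r \<oplus>\<^bsub>P.A\<^esub> x \<in> gen_span"

lemma span_closed: "x \<in> gen_span \<Longrightarrow> x \<in> carrier P.A"
  by (induction rule: gen_span.induct) auto

lemma span_add: "\<lbrakk>x \<in> gen_span; y \<in> gen_span\<rbrakk> \<Longrightarrow> x \<oplus>\<^bsub>P.A\<^esub> y \<in> gen_span"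
  by (induction rule: gen_span.induct)
    (auto simp: P.A.M.a_assoc span_closed intro: gen_span.add)

lemma span_gen: "\<lbrakk>d \<in> carrier B; r \<in> carrier R\<rbrakk> \<Longrightarrow> gen d r \<in> gen_span"
  using gen_span.add[OF _ _ gen_span.zero] by force

lemma span_smult: "\<lbrakk>x \<in> gen_span; a \<in> carrier R\<rbrakk> \<Longrightarrow> a \<odot>\<^bsub>P.A\<^esub> x \<in> gen_span"
  by (induction rule: gen_span.induct)
    (auto simp: P.A.smult_r_distr span_closed gen_act intro: gen_span.intros)

lemma zero_mult_A [simp]: "x \<in> carrier P.A \<Longrightarrow> \<zero>\<^bsub>P.A\<^esub> \<otimes>\<^bsub>P.A\<^esub> x = \<zero>\<^bsub>P.A\<^esub>"
  using P.smult_mult_A[of "\<zero>\<^bsub>R\<^esub>" "\<zero>\<^bsub>P.A\<^esub>" x] by simp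

lemma span_gen_mult:
  assumes "x \<in> gen_span" "d \<in> carrier B" "r \<in> carrier R"
  shows "x \<otimes>\<^bsub>P.A\<^esub> gen d r \<in> gen_span"
  using assms
  by (induction rule: gen_span.induct)
    (auto simp: P.mult_distr_A span_closed gen_mult intro: gen_span.intros)

lemma span_mult: "\<lbrakk>y \<in> gen_span; x \<in> gen_span\<rbrakk> \<Longrightarrow> x \<otimes>\<^bsub>P.A\<^esub> y \<in> gen_span"
proof (induction rule: gen_span.induct)
  case zero
  then show ?case
    using P.mult_comm_A[of x "\<zero>\<^bsub>P.A\<^esub>"] by (simp add: span_closed gen_span.zero)
next
  case (add d r y)
  have "x \<otimes>\<^bsub>P.A\<^esub> (gen d r \<oplus>\<^bsub>P.A\<^esub> y) = x \<otimes>\<^bsub>P.A\<^esub> gen d r \<oplus>\<^bsub>P.A\<^esub> x \<otimes>\<^bsub>P.A\<^esub> y"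
    using add P.mult_distr_A[of "gen d r" y x] by (simp add: span_closed P.mult_comm_A)
  then show ?case
    using add by (simp add: span_add span_gen_mult)
qed

lemma cls_span: "t \<in> P.T \<Longrightarrow> P.cls t \<in> gen_span"
proof (induction rule: alg_terms.induct)
  case (Gen g)
  then show ?case using span_gen by (auto simp: gen_def)
next
  case Zero
  then show ?case using gen_span.zero by (simp add: P.zero_cls)
next
  case (Neg t)
  \<comment> \<open>Negation is scalar multiplication by \<open>-1\<close>, under which finite sums
    of generators are already known to be closed.\<close>
  then have "P.cls (Neg t) = (\<ominus>\<^bsub>R\<^esub> \<one>\<^bsub>R\<^esub>) \<odot>\<^bsub>P.A\<^esub> P.cls t"
    by (simp add: P.A.smult_l_minus P.neg_cls)
  then show ?case using Neg by (simp add: span_smult)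
next
  case (Add t u)
  then show ?case using span_add by (simp add: P.add_cls[symmetric])
next
  case (Mul t u)
  then show ?case using span_mult by (simp add: P.mult_cls[symmetric])
next
  case (Scal a t)
  then show ?case using span_smult by (simp add: P.smult_cls[symmetric])
qed

lemma induct_gen [consumes 1, case_names zero gen add]:
  assumes "x \<in> carrier P.A"
    and "Q \<zero>\<^bsub>P.A\<^esub>"
    and "\<And>d r. \<lbrakk>d \<in> carrier B; r \<in> carrier R\<rbrakk> \<Longrightarrow> Q (gen d r)"
    and "\<And>x y. \<lbrakk>x \<in> carrier P.A; y \<in> carrier P.A; Q x; Q y\<rbrakk> \<Longrightarrow> Q (x \<oplus>\<^bsub>P.A\<^esub> y)"
  shows "Q x"
proof -
  from assms(1) have "x \<in> gen_span"
    using cls_span by (auto elim: P.cls_cases)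
  then show ?thesis
    by induction (auto intro: assms span_closed)
qed

text \<open>The conditions under which \<open>(d, r) |-> r u(d)\<close> respects
  \<open>sum_rels\<close>, \<open>balance_rels\<close> and \<open>scalar_rels\<close>. Products
  impose no condition on \<open>u\<close>: the clause of \<open>eval_term\<close> for
  \<open>Mul\<close> makes \<open>mult_rels\<close> hold.\<close>

definition semilinear :: "('r, 'n) module \<Rightarrow> ('a \<Rightarrow> 'n) \<Rightarrow> bool" where
  "semilinear N u \<longleftrightarrow> u \<in> carrier B \<rightarrow> carrier N \<and>
     (\<forall>x\<in>carrier B. \<forall>y\<in>carrier B. u (x \<oplus>\<^bsub>B\<^esub> y) = u x \<oplus>\<^bsub>N\<^esub> u y) \<and>
     (\<forall>s\<in>carrier S. \<forall>x\<in>carrier B. u (act s x) = phi s \<odot>\<^bsub>N\<^esub> u x) \<and>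
     (\<forall>c\<in>carrier K. \<forall>x\<in>carrier B. u (c \<odot>\<^bsub>B\<^esub> x) = (c \<odot>\<^bsub>R\<^esub> \<one>\<^bsub>R\<^esub>) \<odot>\<^bsub>N\<^esub> u x)"

abbreviation ev where "ev N u t \<equiv> eval_term N (monoid.mult B) u t"

text \<open>Maps that are exchanged below, for instance by associativity in \<open>B\<close>, agree
  on the carrier but may differ outside it, so they cannot be substituted as functions.\<close>

lemma ev_cong:
  assumes "t \<in> P.T" "\<And>d. d \<in> carrier B \<Longrightarrow> u d = v d"
  shows "ev N u t = ev N v t"
  using assms
proof (induction arbitrary: u v rule: alg_terms.induct)
  case (Mul t t')
  show ?case
    unfolding eval_term.simps by (intro Mul.IH Mul.prems) auto
next
  case (Neg t)
  show ?case using Neg.IH[OF Neg.prems] by simp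
next
  case (Add t t')
  show ?case using Add.IH[OF Add.prems] by simp
next
  case (Scal a t)
  show ?case using Scal.IH[OF Scal.prems] by simp
qed auto

lemma additive_eqI:
  assumes H: "abelian_group H"
    and F: "additive_map P.A H F" and G: "additive_map P.A H G"
    and gens: "\<And>d r. \<lbrakk>d \<in> carrier B; r \<in> carrier R\<rbrakk> \<Longrightarrow> F (gen d r) = G (gen d r)"
    and x: "x \<in> carrier P.A"
  shows "F x = G x"
  using x
proof (induction rule: induct_gen)
  case zero
  interpret H: abelian_group H by fact
  have "F' \<zero>\<^bsub>P.A\<^esub> = \<zero>\<^bsub>H\<^esub>" if "additive_map P.A H F'" for F'
  proof -
    have "F' \<zero>\<^bsub>P.A\<^esub> \<in> carrier H" "F' \<zero>\<^bsub>P.A\<^esub> = F' \<zero>\<^bsub>P.A\<^esub> \<oplus>\<^bsub>H\<^esub> F' \<zero>\<^bsub>P.A\<^esub>"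
      using that P.A.M.zero_closed P.A.M.l_zero[OF P.A.M.zero_closed] unfolding additive_map_def by force+
    then show ?thesis by (metis H.add.l_cancel_one')
  qed
  from this[OF F] this[OF G] show ?case by simp
next
  case (add x y)
  then show ?case using F G by (simp add: additive_map_def)
qed (use gens in auto)

text \<open>\<open>K\<close> acts through the ring map \<open>c |-> c 1\<close> into
  \<open>R\<close>; the equation for \<open>a\<close> and \<open>b\<close> in the proof is the
  multiplicativity of this map.\<close>

lemma comm_alg_restrict: "comm_alg K (restrict_scalars R P.A)"
proof -
  have c: "c \<odot>\<^bsub>R\<^esub> \<one>\<^bsub>R\<^esub> \<in> carrier R" if "c \<in> carrier K" for c
    using that by simp
  have "module K (restrict_scalars R P.A)"
  proof (rule moduleI)
    show "abelian_group (restrict_scalars R P.A)"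
      by (rule abelian_groupI) (auto simp: P.A.M.a_ac intro: P.A.M.l_neg)
  next
    fix a b x assume "a \<in> carrier K" "b \<in> carrier K" "x \<in> carrier (restrict_scalars R P.A)"
    moreover have "(a \<otimes>\<^bsub>K\<^esub> b) \<odot>\<^bsub>R\<^esub> \<one>\<^bsub>R\<^esub> = (a \<odot>\<^bsub>R\<^esub> \<one>\<^bsub>R\<^esub>) \<otimes>\<^bsub>R\<^esub> (b \<odot>\<^bsub>R\<^esub> \<one>\<^bsub>R\<^esub>)"
      if "a \<in> carrier K" "b \<in> carrier K"
      using that by (simp add: R.smult_assoc1 R.smult_assoc2)
    ultimately show "(a \<otimes>\<^bsub>K\<^esub> b) \<odot>\<^bsub>restrict_scalars R P.A\<^esub> x =
        a \<odot>\<^bsub>restrict_scalars R P.A\<^esub> (b \<odot>\<^bsub>restrict_scalars R P.A\<^esub> x)"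
      by (simp add: P.A.smult_assoc1)
  qed (auto simp: c P.A.smult_l_distr P.A.smult_r_distr R.smult_l_distr R.R.is_cring)
  then show ?thesis
    by (intro comm_alg.intro comm_alg_axioms.intro)
      (auto simp: P.mult_assoc_A P.mult_distr_A P.smult_mult_A
        del: equalityI intro: P.mult_comm_A)
qed

lemma gen_minus:
  assumes "d \<in> carrier B" "d' \<in> carrier B" "r \<in> carrier R"
  shows "gen (d \<ominus>\<^bsub>B\<^esub> d') r = gen d r \<ominus>\<^bsub>P.A\<^esub> gen d' r"
proof -
  have "gen (d \<ominus>\<^bsub>B\<^esub> d') r \<oplus>\<^bsub>P.A\<^esub> gen d' r = gen (d \<ominus>\<^bsub>B\<^esub> d' \<oplus>\<^bsub>B\<^esub> d') r"
    using assms by (simp add: gen_add)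
  also have "d \<ominus>\<^bsub>B\<^esub> d' \<oplus>\<^bsub>B\<^esub> d' = d"
    using assms by (simp add: B.minus_eq B.a_assoc B.l_neg)
  finally show ?thesis
    using assms by (metis P.A.M.add.inv_solve_right' P.A.M.minus_eq gen_closed B.minus_closed)
qed

text \<open>The middle algebra is presented with differences, the top algebra with sums. Over an
  abelian group both say that \<open>(d, r)\<close> is additive in \<open>d\<close>.\<close>

lemma cong_diff_rels:
  "alg_cong R gens (mult_rels R B \<union> diff_rels R B \<union> balance_rels S R B phi act \<union> act_rels R B \<union>
    scalar_rels K R B) = P.C" (is "alg_cong R gens ?E = _")
proof (intro equalityI alg_cong_least)
  fix t u assume tu: "(t, u) \<in> ?E" "t \<in> P.T" "u \<in> P.T"
  show "(t, u) \<in> P.C"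
  proof (cases "(t, u) \<in> diff_rels R B")
    case True
    then obtain d d' r where *: "t = Add (Gen (d, r)) (Neg (Gen (d', r)))"
      "u = Gen (d \<ominus>\<^bsub>B\<^esub> d', r)" "d \<in> carrier B" "d' \<in> carrier B" "r \<in> carrier R"
      unfolding diff_rels_def by blast
    then have "P.cls t = P.cls u"
      using gen_minus[of d d' r]
      by (simp add: gen_def P.A.M.minus_eq P.cls_ops P.neg_cls P.term_intros)
    then show ?thesis using P.cls_eq_iff tu by blast
  next
    case False
    then show ?thesis
      using tu by (intro alg_cong.rel) (auto simp: base_change_rels_def)
  qed
next
  \<comment> \<open>The quotient by the relations with differences is itself an abelian group, so
    the sum relation can be obtained there by solving an equation.\<close>
  interpret E: presentation R gens ?E ..
  fix t u assume tu: "(t, u) \<in> rels" "t \<in> P.T" "u \<in> P.T"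
  show "(t, u) \<in> E.C"
  proof (cases "(t, u) \<in> sum_rels R B")
    case True
    then obtain d d' r where *: "t = Add (Gen (d, r)) (Gen (d', r))"
      "u = Gen (d \<oplus>\<^bsub>B\<^esub> d', r)" "d \<in> carrier B" "d' \<in> carrier B" "r \<in> carrier R"
      unfolding sum_rels_def by blast
    let ?g = "\<lambda>d. E.cls (Gen (d, r))"
    \<comment> \<open>The difference relation for \<open>d + d'\<close> and \<open>d'\<close> gives
      \<open>(d + d', r) - (d', r) = (d, r)\<close>.\<close>
    have "(Add (Gen (d \<oplus>\<^bsub>B\<^esub> d', r)) (Neg (Gen (d', r))), Gen (d \<oplus>\<^bsub>B\<^esub> d' \<ominus>\<^bsub>B\<^esub> d', r)) \<in> ?E"
      using * unfolding diff_rels_def by blast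
    moreover have "d \<oplus>\<^bsub>B\<^esub> d' \<ominus>\<^bsub>B\<^esub> d' = d"
      using * by (simp add: B.minus_eq B.a_assoc B.r_neg)
    ultimately have "E.cls (Add (Gen (d \<oplus>\<^bsub>B\<^esub> d', r)) (Neg (Gen (d', r)))) = ?g d"
      using * by (intro E.cls_eqI alg_cong.rel) (auto intro: alg_terms.intros)
    then have "?g (d \<oplus>\<^bsub>B\<^esub> d') \<ominus>\<^bsub>E.A\<^esub> ?g d' = ?g d"
      using * by (simp add: E.cls_ops E.neg_cls E.A.M.minus_eq E.term_intros)
    moreover have cl: "?g (d \<oplus>\<^bsub>B\<^esub> d') \<in> carrier E.A" "?g d' \<in> carrier E.A" "?g d \<in> carrier E.A"
      using * by auto
    ultimately have "?g (d \<oplus>\<^bsub>B\<^esub> d') = ?g d \<oplus>\<^bsub>E.A\<^esub> ?g d'"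
      by (metis E.A.M.add.inv_solve_right' E.A.M.minus_eq)
    then have "E.cls t = E.cls u"
      using * by (simp add: E.cls_ops)
    then show ?thesis using E.cls_eq_iff tu by blast
  next
    case False
    then show ?thesis
      using tu by (intro alg_cong.rel) (auto simp: base_change_rels_def)
  qed
qed

lemma scalar_mult:
  "\<lbrakk>c \<in> carrier K; r \<in> carrier R\<rbrakk> \<Longrightarrow> (c \<odot>\<^bsub>R\<^esub> \<one>\<^bsub>R\<^esub>) \<otimes>\<^bsub>R\<^esub> r = c \<odot>\<^bsub>R\<^esub> r"
  by (simp add: R.smult_assoc2)

lemma action_restrict: "alg_action K R (restrict_scalars R P.A) (smult P.A)"
proof -
  have "(c \<odot>\<^bsub>R\<^esub> a) \<odot>\<^bsub>P.A\<^esub> x = (c \<odot>\<^bsub>R\<^esub> \<one>\<^bsub>R\<^esub>) \<odot>\<^bsub>P.A\<^esub> (a \<odot>\<^bsub>P.A\<^esub> x)"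
    "a \<odot>\<^bsub>P.A\<^esub> ((c \<odot>\<^bsub>R\<^esub> \<one>\<^bsub>R\<^esub>) \<odot>\<^bsub>P.A\<^esub> x) = (c \<odot>\<^bsub>R\<^esub> \<one>\<^bsub>R\<^esub>) \<odot>\<^bsub>P.A\<^esub> (a \<odot>\<^bsub>P.A\<^esub> x)"
    if "c \<in> carrier K" "a \<in> carrier R" "x \<in> carrier P.A" for c a x
    using that by (simp_all add: scalar_mult R.m_comm[of a] flip: P.A.smult_assoc1)
  then show ?thesis
    unfolding alg_action_def bilinear_map_def restrict_scalars_simps
    by (intro conjI ballI)
      (assumption | rule P.A.smult_closed P.A.smult_l_distr P.A.smult_r_distr P.A.smult_assoc1
        P.smult_mult_A[symmetric])+
qed

end

locale base_change_target = base_change K R S B phi act + N: module R N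
  for K :: "'k ring" and R :: "('k, 'r) module" and S :: "('k, 's) module" and B :: "('k, 'a) module"
    and phi :: "'s \<Rightarrow> 'r" and act :: "'s \<Rightarrow> 'a \<Rightarrow> 'a" and N :: "('r, 'n) module"
begin

section \<open>Evaluation at a fixed term is linear in the map \<open>u\<close>\<close>

lemma smult_swap:
  assumes "a \<in> carrier R" "b \<in> carrier R" "x \<in> carrier N"
  shows "a \<odot>\<^bsub>N\<^esub> (b \<odot>\<^bsub>N\<^esub> x) = b \<odot>\<^bsub>N\<^esub> (a \<odot>\<^bsub>N\<^esub> x)"
  using assms by (metis N.smult_assoc1 R.m_comm)

lemma ev_closed:
  assumes "t \<in> P.T" "\<And>d. d \<in> carrier B \<Longrightarrow> u d \<in> carrier N"
  shows "ev N u t \<in> carrier N"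
  using assms
  by (induction arbitrary: u rule: alg_terms.induct) auto

lemma ev_add:
  assumes "t \<in> P.T" "\<And>d. d \<in> carrier B \<Longrightarrow> u d \<in> carrier N" "\<And>d. d \<in> carrier B \<Longrightarrow> v d \<in> carrier N"
  shows "ev N (\<lambda>d. u d \<oplus>\<^bsub>N\<^esub> v d) t = ev N u t \<oplus>\<^bsub>N\<^esub> ev N v t"
  using assms
proof (induction arbitrary: u v rule: alg_terms.induct)
  case (Mul t t')
  \<comment> \<open>The induction hypothesis is used twice: for the inner evaluation at
    \<open>t'\<close> with \<open>d\<close> fixed, then for the outer one at
    \<open>t\<close>.\<close>
  have "ev N (\<lambda>d. u d \<oplus>\<^bsub>N\<^esub> v d) (Mul t t') =
      ev N (\<lambda>d. ev N (\<lambda>d'. u (d \<otimes>\<^bsub>B\<^esub> d')) t' \<oplus>\<^bsub>N\<^esub> ev N (\<lambda>d'. v (d \<otimes>\<^bsub>B\<^esub> d')) t') t"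
    unfolding eval_term.simps using Mul by (intro ev_cong Mul.IH) auto
  also have "\<dots> = ev N u (Mul t t') \<oplus>\<^bsub>N\<^esub> ev N v (Mul t t')"
    unfolding eval_term.simps using Mul by (intro Mul.IH) (auto intro: ev_closed)
  finally show ?case .
next
  case (Add t t')
  have "ev N u t \<in> carrier N" "ev N v t \<in> carrier N" "ev N u t' \<in> carrier N" "ev N v t' \<in> carrier N"
    using Add by (auto intro: ev_closed)
  then show ?case using Add by (simp add: N.M.a_ac)
qed (auto simp: N.smult_r_distr ev_closed N.M.minus_add)

lemma ev_smult:
  assumes "t \<in> P.T" "\<And>d. d \<in> carrier B \<Longrightarrow> u d \<in> carrier N" "a \<in> carrier R"
  shows "ev N (\<lambda>d. a \<odot>\<^bsub>N\<^esub> u d) t = a \<odot>\<^bsub>N\<^esub> ev N u t"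
  using assms
proof (induction arbitrary: u rule: alg_terms.induct)
  case (Mul t t')
  have "ev N (\<lambda>d. a \<odot>\<^bsub>N\<^esub> u d) (Mul t t') =
      ev N (\<lambda>d. a \<odot>\<^bsub>N\<^esub> ev N (\<lambda>d'. u (d \<otimes>\<^bsub>B\<^esub> d')) t') t"
    unfolding eval_term.simps using Mul by (intro ev_cong Mul.IH) auto
  also have "\<dots> = a \<odot>\<^bsub>N\<^esub> ev N u (Mul t t')"
    unfolding eval_term.simps using Mul by (intro Mul.IH) (auto intro: ev_closed)
  finally show ?case .
next
  case (Gen g)
  then show ?case using smult_swap by auto
next
  case (Scal b t)
  then show ?case using smult_swap by (simp add: ev_closed)
qed (auto simp: N.smult_r_distr N.smult_r_minus ev_closed)

lemma ev_neg:
  assumes "t \<in> P.T" "\<And>d. d \<in> carrier B \<Longrightarrow> u d \<in> carrier N"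
  shows "ev N (\<lambda>d. \<ominus>\<^bsub>N\<^esub> u d) t = \<ominus>\<^bsub>N\<^esub> ev N u t"
proof -
  have "ev N (\<lambda>d. \<ominus>\<^bsub>N\<^esub> u d) t = ev N (\<lambda>d. (\<ominus>\<^bsub>R\<^esub> \<one>\<^bsub>R\<^esub>) \<odot>\<^bsub>N\<^esub> u d) t"
    using assms by (intro ev_cong) (auto simp: N.smult_l_minus)
  then show ?thesis
    using assms by (simp add: ev_smult N.smult_l_minus ev_closed)
qed

lemma ev_zero:
  assumes "t \<in> P.T"
  shows "ev N (\<lambda>d. \<zero>\<^bsub>N\<^esub>) t = \<zero>\<^bsub>N\<^esub>"
  using ev_smult[OF assms, of "\<lambda>d. \<zero>\<^bsub>N\<^esub>" "\<zero>\<^bsub>R\<^esub>"] assms by (simp add: ev_closed)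

text \<open>Exchange of two finite sums. Linearity of the evaluation in its map carries the inner
  evaluation through every term constructor of \<open>t\<close>.\<close>

lemma ev_swap:
  assumes "t \<in> P.T" "x \<in> P.T" "\<And>d d'. \<lbrakk>d \<in> carrier B; d' \<in> carrier B\<rbrakk> \<Longrightarrow> w d d' \<in> carrier N"
  shows "ev N (\<lambda>d. ev N (\<lambda>d'. w d d') x) t = ev N (\<lambda>d'. ev N (\<lambda>d. w d d') t) x"
  using assms
proof (induction arbitrary: w rule: alg_terms.induct)
  case (Mul t t')
  have "ev N (\<lambda>d. ev N (\<lambda>d'. w d d') x) (Mul t t') =
      ev N (\<lambda>d. ev N (\<lambda>d'. ev N (\<lambda>e. w (d \<otimes>\<^bsub>B\<^esub> e) d') t') x) t"
    unfolding eval_term.simps using Mul by (intro ev_cong Mul.IH) auto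
  also have "\<dots> = ev N (\<lambda>d'. ev N (\<lambda>d. ev N (\<lambda>e. w (d \<otimes>\<^bsub>B\<^esub> e) d') t') t) x"
    using Mul by (intro Mul.IH) (auto intro: ev_closed)
  finally show ?case by simp
qed (auto simp: ev_zero ev_neg ev_add ev_smult ev_closed)

section \<open>Congruent terms have equal values\<close>

lemma semilinear_mult_right:
  assumes "semilinear N u" "d \<in> carrier B"
  shows "semilinear N (\<lambda>d'. u (d \<otimes>\<^bsub>B\<^esub> d'))"
  using assms unfolding semilinear_def
  by (auto simp: distr_right act_mult_right smult_mult_right Pi_iff)

lemma semilinear_mult_left:
  assumes "semilinear N u" "d \<in> carrier B"
  shows "semilinear N (\<lambda>d'. u (d' \<otimes>\<^bsub>B\<^esub> d))"
  using assms unfolding semilinear_def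
  by (auto simp: B.mult_distr act_mult_left B.smult_mult Pi_iff)

lemma semilinearD:
  assumes "semilinear N u"
  shows "d \<in> carrier B \<Longrightarrow> u d \<in> carrier N"
    and "\<lbrakk>d \<in> carrier B; d' \<in> carrier B\<rbrakk> \<Longrightarrow> u (d \<oplus>\<^bsub>B\<^esub> d') = u d \<oplus>\<^bsub>N\<^esub> u d'"
    and "\<lbrakk>s \<in> carrier S; d \<in> carrier B\<rbrakk> \<Longrightarrow> u (act s d) = phi s \<odot>\<^bsub>N\<^esub> u d"
    and "\<lbrakk>c \<in> carrier K; d \<in> carrier B\<rbrakk> \<Longrightarrow> u (c \<odot>\<^bsub>B\<^esub> d) = (c \<odot>\<^bsub>R\<^esub> \<one>\<^bsub>R\<^esub>) \<odot>\<^bsub>N\<^esub> u d"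
  using assms unfolding semilinear_def by auto

text \<open>Evaluation at \<open>t\<close> is linear in the map, so what \<open>w\<close> satisfies
  in its first variable survives evaluation in the second. This makes the outer map in the
  evaluation of a product semilinear again.\<close>

lemma semilinear_ev:
  assumes w: "\<And>d'. d' \<in> carrier B \<Longrightarrow> semilinear N (\<lambda>d. w d d')" and t: "t \<in> P.T"
  shows "semilinear N (\<lambda>d. ev N (w d) t)"
proof -
  note D = semilinearD[OF w]
  have "ev N (w (x \<oplus>\<^bsub>B\<^esub> y)) t = ev N (w x) t \<oplus>\<^bsub>N\<^esub> ev N (w y) t"
    if "x \<in> carrier B" "y \<in> carrier B" for x y
  proof -
    have "ev N (w (x \<oplus>\<^bsub>B\<^esub> y)) t = ev N (\<lambda>d. w x d \<oplus>\<^bsub>N\<^esub> w y d) t"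
      using that t D by (intro ev_cong) auto
    then show ?thesis using that t D by (simp add: ev_add)
  qed
  moreover have "ev N (w (act s x)) t = phi s \<odot>\<^bsub>N\<^esub> ev N (w x) t"
    if "s \<in> carrier S" "x \<in> carrier B" for s x
  proof -
    have "ev N (w (act s x)) t = ev N (\<lambda>d. phi s \<odot>\<^bsub>N\<^esub> w x d) t"
      using that t D by (intro ev_cong) auto
    then show ?thesis using that t D by (simp add: ev_smult)
  qed
  moreover have "ev N (w (c \<odot>\<^bsub>B\<^esub> x)) t = (c \<odot>\<^bsub>R\<^esub> \<one>\<^bsub>R\<^esub>) \<odot>\<^bsub>N\<^esub> ev N (w x) t"
    if "c \<in> carrier K" "x \<in> carrier B" for c x
  proof -
    have "ev N (w (c \<odot>\<^bsub>B\<^esub> x)) t = ev N (\<lambda>d. (c \<odot>\<^bsub>R\<^esub> \<one>\<^bsub>R\<^esub>) \<odot>\<^bsub>N\<^esub> w x d) t"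
      using that t D by (intro ev_cong) auto
    then show ?thesis using that t D by (simp add: ev_smult)
  qed
  ultimately show ?thesis
    using t D(1) by (auto simp: semilinear_def ev_closed)
qed

lemma ev_rels:
  assumes u: "semilinear N u" and rel: "(t, t') \<in> rels"
  shows "ev N u t = ev N u t'"
proof -
  note D = semilinearD[OF u]
  have scal: "(c \<odot>\<^bsub>R\<^esub> r) \<odot>\<^bsub>N\<^esub> x = r \<odot>\<^bsub>N\<^esub> ((c \<odot>\<^bsub>R\<^esub> \<one>\<^bsub>R\<^esub>) \<odot>\<^bsub>N\<^esub> x)"
    if "c \<in> carrier K" "r \<in> carrier R" "x \<in> carrier N" for c r x
  proof -
    have "c \<odot>\<^bsub>R\<^esub> r = r \<otimes>\<^bsub>R\<^esub> (c \<odot>\<^bsub>R\<^esub> \<one>\<^bsub>R\<^esub>)"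
      using that R.smult_assoc2[of c "\<one>\<^bsub>R\<^esub>" r] by (simp add: R.m_comm)
    then show ?thesis using that by (simp add: N.smult_assoc1)
  qed
  consider (1) "(t, t') \<in> mult_rels R B \<union> sum_rels R B \<union> balance_rels S R B phi act \<union> act_rels R B"
    | (2) "(t, t') \<in> scalar_rels K R B"
    using rel unfolding base_change_rels_def by blast
  then show ?thesis
  proof cases
    case 1
    then show ?thesis
      using D by (auto simp: mult_rels_def sum_rels_def balance_rels_def act_rels_def
          N.smult_r_distr N.smult_assoc1 smult_swap)
  next
    case 2
    then obtain c d r where "t = Gen (c \<odot>\<^bsub>B\<^esub> d, r)" "t' = Gen (d, c \<odot>\<^bsub>R\<^esub> r)"
      "c \<in> carrier K" "d \<in> carrier B" "r \<in> carrier R"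
      unfolding scalar_rels_def by blast
    then show ?thesis
      using D scal[of c r "u d"] by simp
  qed
qed

lemma ev_sound:
  assumes "(t, t') \<in> P.C" "semilinear N u"
  shows "ev N u t = ev N u t'"
  using assms
proof (induction arbitrary: u rule: alg_cong.induct)
  case (rel t t')
  then show ?case by (auto intro: ev_rels)
next
  case (trans t t' t'')
  show ?case using trans.IH[OF trans.prems] by simp
next
  case (sym t t')
  show ?case using sym.IH[OF sym.prems] by simp
next
  case (mul_cong t t' x x')
  then have T: "t \<in> P.T" "t' \<in> P.T" "x \<in> P.T" "x' \<in> P.T"
    using P.cong_terms by auto
  \<comment> \<open>The hypothesis for \<open>x\<close> is applied to the semilinear map
    \<open>d' |-> u (d d')\<close>, for each \<open>d\<close>.\<close>
  have "ev N u (Mul t x) = ev N (\<lambda>d. ev N (\<lambda>d'. u (d \<otimes>\<^bsub>B\<^esub> d')) x') t"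
    unfolding eval_term.simps using mul_cong T semilinear_mult_right by (intro ev_cong) auto
  \<comment> \<open>Now the hypothesis for \<open>t\<close> is applied to the map obtained by
    evaluating at \<open>x'\<close>.\<close>
  also have "\<dots> = ev N (\<lambda>d. ev N (\<lambda>d'. u (d \<otimes>\<^bsub>B\<^esub> d')) x') t'"
    using mul_cong.prems T semilinear_mult_left by (intro mul_cong.IH semilinear_ev) auto
  finally show ?case by simp
next
  case (mul_assoc t x v)
  have "ev N u (Mul (Mul t x) v) =
      ev N (\<lambda>d. ev N (\<lambda>d'. ev N (\<lambda>e. u (d \<otimes>\<^bsub>B\<^esub> (d' \<otimes>\<^bsub>B\<^esub> e))) v) x) t"
    \<comment> \<open>Both bracketings unfold to a triple evaluation; they differ only by
      associativity in \<open>B\<close> under \<open>u\<close>.\<close>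
    unfolding eval_term.simps using mul_assoc by (intro ev_cong) (auto simp: B.mult_assoc)
  then show ?case by simp
next
  case (mul_comm t x)
  have "ev N u (Mul t x) = ev N (\<lambda>d'. ev N (\<lambda>d. u (d \<otimes>\<^bsub>B\<^esub> d')) t) x"
    unfolding eval_term.simps using mul_comm semilinearD(1)[OF mul_comm(3)] by (intro ev_swap) auto
  also have "\<dots> = ev N u (Mul x t)"
    unfolding eval_term.simps using mul_comm by (intro ev_cong) (auto simp: B.mult_comm)
  finally show ?case .
next
  case (neg_cong t t')
  show ?case using neg_cong.IH[OF neg_cong.prems] by simp
next
  case (add_cong t t' x x')
  show ?case using add_cong.IH[OF add_cong.prems] by simp
next
  case (scal_cong a t t')
  show ?case using scal_cong.IH[OF scal_cong.prems] by simp
next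
  case (scal_mul a t x)
  then have "\<And>d d'. \<lbrakk>d \<in> carrier B; d' \<in> carrier B\<rbrakk> \<Longrightarrow> u (d \<otimes>\<^bsub>B\<^esub> d') \<in> carrier N"
    by (auto intro: semilinearD(1))
  then show ?case by (simp)
qed (simp_all add: semilinearD(1) ev_closed N.M.a_ac N.M.l_neg N.M.r_neg
    N.smult_l_distr N.smult_r_distr N.smult_assoc1)

section \<open>Linear and bilinear extension to the base change\<close>

lemma ext_image:
  assumes "semilinear N u" "t \<in> P.T"
  shows "ev N u ` P.cls t = {ev N u t}"
proof -
  have "t \<in> P.cls t" using assms by (auto intro: alg_cong.refl)
  moreover have "ev N u t' = ev N u t" if "t' \<in> P.cls t" for t'
    using that ev_sound[of t t' u] assms by auto
  ultimately show ?thesis by blast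
qed

text \<open>The common value of all terms in a class: for semilinear \<open>u\<close> the image of a
  class is a singleton.\<close>

definition ext :: "('a \<Rightarrow> 'n) \<Rightarrow> ('r, 'a \<times> 'r) alg_term set \<Rightarrow> 'n" where
  "ext u x = the_elem (ev N u ` x)"

lemma ext_cls: "\<lbrakk>semilinear N u; t \<in> P.T\<rbrakk> \<Longrightarrow> ext u (P.cls t) = ev N u t"
  by (simp add: ext_def ext_image)

lemma ext_closed [simp, intro]: "\<lbrakk>semilinear N u; x \<in> carrier P.A\<rbrakk> \<Longrightarrow> ext u x \<in> carrier N"
  by (elim P.cls_cases) (simp add: ext_cls ev_closed semilinearD)

lemma ext_add: "\<lbrakk>semilinear N u; x \<in> carrier P.A; y \<in> carrier P.A\<rbrakk> \<Longrightarrow>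
    ext u (x \<oplus>\<^bsub>P.A\<^esub> y) = ext u x \<oplus>\<^bsub>N\<^esub> ext u y"
  by (elim P.cls_cases) (simp add: ext_cls P.cls_ops P.term_intros)

lemma ext_smult: "\<lbrakk>semilinear N u; a \<in> carrier R; x \<in> carrier P.A\<rbrakk> \<Longrightarrow>
    ext u (a \<odot>\<^bsub>P.A\<^esub> x) = a \<odot>\<^bsub>N\<^esub> ext u x"
  by (elim P.cls_cases) (simp add: ext_cls P.cls_ops P.term_intros)

lemma ext_gen: "\<lbrakk>semilinear N u; d \<in> carrier B; r \<in> carrier R\<rbrakk> \<Longrightarrow> ext u (gen d r) = r \<odot>\<^bsub>N\<^esub> u d"
  by (simp add: gen_def ext_cls)

lemma semilinear_cong:
  assumes "semilinear N u" "\<And>d. d \<in> carrier B \<Longrightarrow> u d = v d"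
  shows "semilinear N v"
  using assms unfolding semilinear_def by (simp add: Pi_iff)

text \<open>For \<open>w\<close> semilinear in each variable this is the bilinear extension.
  Linearity in \<open>x\<close> is that of \<open>ext\<close>; linearity in the inner variable
  \<open>y\<close> comes instead from linearity of the outer evaluation in its map, which is why
  \<open>bil_cls\<close> goes back to terms.\<close>

definition bil :: "('a \<Rightarrow> 'a \<Rightarrow> 'n) \<Rightarrow> ('r, 'a \<times> 'r) alg_term set \<Rightarrow> ('r, 'a \<times> 'r) alg_term set \<Rightarrow> 'n" where
  "bil w x y = ext (\<lambda>d. ext (w d) y) x"

context
  fixes w
  assumes left: "\<And>d'. d' \<in> carrier B \<Longrightarrow> semilinear N (\<lambda>d. w d d')"
    and right: "\<And>d. d \<in> carrier B \<Longrightarrow> semilinear N (w d)"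
begin

lemma semilinear_ext:
  assumes "y \<in> carrier P.A"
  shows "semilinear N (\<lambda>d. ext (w d) y)"
proof -
  obtain t where "t \<in> P.T" "y = P.cls t" using assms by (rule P.cls_cases)
  then show ?thesis
    using right semilinear_cong[OF semilinear_ev[of w t, OF left]] by (simp add: ext_cls)
qed

lemma bil_cls:
  assumes "t \<in> P.T" "t' \<in> P.T"
  shows "bil w (P.cls t) (P.cls t') = ev N (\<lambda>d. ev N (w d) t') t"
  using assms semilinear_ext[of "P.cls t'"] right
  by (auto simp: bil_def ext_cls intro: ev_cong)

lemma bil_closed [simp, intro]:
  "\<lbrakk>x \<in> carrier P.A; y \<in> carrier P.A\<rbrakk> \<Longrightarrow> bil w x y \<in> carrier N"
  by (simp add: bil_def semilinear_ext)

lemma bil_add_left: "\<lbrakk>x \<in> carrier P.A; x' \<in> carrier P.A; y \<in> carrier P.A\<rbrakk> \<Longrightarrow>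
    bil w (x \<oplus>\<^bsub>P.A\<^esub> x') y = bil w x y \<oplus>\<^bsub>N\<^esub> bil w x' y"
  by (simp add: bil_def semilinear_ext ext_add)

lemma bil_smult_left: "\<lbrakk>a \<in> carrier R; x \<in> carrier P.A; y \<in> carrier P.A\<rbrakk> \<Longrightarrow>
    bil w (a \<odot>\<^bsub>P.A\<^esub> x) y = a \<odot>\<^bsub>N\<^esub> bil w x y"
  by (simp add: bil_def semilinear_ext ext_smult)

lemma bil_add_right: "\<lbrakk>x \<in> carrier P.A; y \<in> carrier P.A; y' \<in> carrier P.A\<rbrakk> \<Longrightarrow>
    bil w x (y \<oplus>\<^bsub>P.A\<^esub> y') = bil w x y \<oplus>\<^bsub>N\<^esub> bil w x y'"
  by (elim P.cls_cases)
    (simp add: bil_cls P.cls_ops P.term_intros ev_add ev_closed semilinearD(1)[OF right])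

lemma bil_smult_right: "\<lbrakk>a \<in> carrier R; x \<in> carrier P.A; y \<in> carrier P.A\<rbrakk> \<Longrightarrow>
    bil w x (a \<odot>\<^bsub>P.A\<^esub> y) = a \<odot>\<^bsub>N\<^esub> bil w x y"
  by (elim P.cls_cases)
    (simp add: bil_cls P.cls_ops P.term_intros ev_smult ev_closed semilinearD(1)[OF right])

lemma bil_gen: "\<lbrakk>d \<in> carrier B; d' \<in> carrier B; r \<in> carrier R; r' \<in> carrier R\<rbrakk> \<Longrightarrow>
    bil w (gen d r) (gen d' r') = (r \<otimes>\<^bsub>R\<^esub> r') \<odot>\<^bsub>N\<^esub> w d d'"
  by (simp add: bil_def semilinear_ext ext_gen right N.smult_assoc1 semilinearD(1)[OF right])

end

text \<open>Both sides are additive in \<open>x\<close> and in \<open>y\<close>, and on generators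
  the claim is multiplicativity of \<open>u\<close>. The laws for the product of \<open>N\<close>
  are spelled out as hypotheses because \<open>comm_alg\<close> has a plain ring as its base,
  whereas \<open>R\<close> is a \<open>module\<close> record.\<close>

lemma ext_mult:
  assumes u: "semilinear N u"
    and closed: "\<And>x y. \<lbrakk>x \<in> carrier N; y \<in> carrier N\<rbrakk> \<Longrightarrow> x \<otimes>\<^bsub>N\<^esub> y \<in> carrier N"
    and comm: "\<And>x y. \<lbrakk>x \<in> carrier N; y \<in> carrier N\<rbrakk> \<Longrightarrow> x \<otimes>\<^bsub>N\<^esub> y = y \<otimes>\<^bsub>N\<^esub> x"
    and distr: "\<And>x y z. \<lbrakk>x \<in> carrier N; y \<in> carrier N; z \<in> carrier N\<rbrakk> \<Longrightarrow>
      (x \<oplus>\<^bsub>N\<^esub> y) \<otimes>\<^bsub>N\<^esub> z = x \<otimes>\<^bsub>N\<^esub> z \<oplus>\<^bsub>N\<^esub> y \<otimes>\<^bsub>N\<^esub> z"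
    and smult: "\<And>a x y. \<lbrakk>a \<in> carrier R; x \<in> carrier N; y \<in> carrier N\<rbrakk> \<Longrightarrow>
      (a \<odot>\<^bsub>N\<^esub> x) \<otimes>\<^bsub>N\<^esub> y = a \<odot>\<^bsub>N\<^esub> (x \<otimes>\<^bsub>N\<^esub> y)"
    and mult: "\<And>d d'. \<lbrakk>d \<in> carrier B; d' \<in> carrier B\<rbrakk> \<Longrightarrow> u (d \<otimes>\<^bsub>B\<^esub> d') = u d \<otimes>\<^bsub>N\<^esub> u d'"
    and xy: "x \<in> carrier P.A" "y \<in> carrier P.A"
  shows "ext u (x \<otimes>\<^bsub>P.A\<^esub> y) = ext u x \<otimes>\<^bsub>N\<^esub> ext u y"
proof (rule additive_eqI[OF N.abelian_group_axioms, where x = x])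
  have right: "z \<otimes>\<^bsub>N\<^esub> (x \<oplus>\<^bsub>N\<^esub> y) = z \<otimes>\<^bsub>N\<^esub> x \<oplus>\<^bsub>N\<^esub> z \<otimes>\<^bsub>N\<^esub> y"
    if "x \<in> carrier N" "y \<in> carrier N" "z \<in> carrier N" for x y z
    using that distr[of x y z] comm by simp
  have rightA: "z \<otimes>\<^bsub>P.A\<^esub> (x \<oplus>\<^bsub>P.A\<^esub> y) = z \<otimes>\<^bsub>P.A\<^esub> x \<oplus>\<^bsub>P.A\<^esub> z \<otimes>\<^bsub>P.A\<^esub> y"
    if "x \<in> carrier P.A" "y \<in> carrier P.A" "z \<in> carrier P.A" for x y z
    using that P.mult_distr_A[of x y z] by (simp add: P.mult_comm_A)
  show "additive_map P.A N (\<lambda>x. ext u (x \<otimes>\<^bsub>P.A\<^esub> y))" "additive_map P.A N (\<lambda>x. ext u x \<otimes>\<^bsub>N\<^esub> ext u y)"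
    using u xy by (auto simp: additive_map_def P.mult_distr_A ext_add distr closed)
  fix d r assume dr: "d \<in> carrier B" "r \<in> carrier R"
  show "ext u (gen d r \<otimes>\<^bsub>P.A\<^esub> y) = ext u (gen d r) \<otimes>\<^bsub>N\<^esub> ext u y"
  proof (rule additive_eqI[OF N.abelian_group_axioms, where x = y])
    show "additive_map P.A N (\<lambda>y. ext u (gen d r \<otimes>\<^bsub>P.A\<^esub> y))"
      "additive_map P.A N (\<lambda>y. ext u (gen d r) \<otimes>\<^bsub>N\<^esub> ext u y)"
      using u dr by (auto simp: additive_map_def rightA ext_add right closed)
    fix d' r' assume dr': "d' \<in> carrier B" "r' \<in> carrier R"
    have ud: "u d \<in> carrier N" "u d' \<in> carrier N"
      using semilinearD(1)[OF u] dr dr' by auto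
    have "u d \<otimes>\<^bsub>N\<^esub> (r' \<odot>\<^bsub>N\<^esub> u d') = r' \<odot>\<^bsub>N\<^esub> (u d \<otimes>\<^bsub>N\<^esub> u d')"
      using ud dr' smult[of r' "u d'" "u d"] by (simp add: comm)
    then show "ext u (gen d r \<otimes>\<^bsub>P.A\<^esub> gen d' r') = ext u (gen d r) \<otimes>\<^bsub>N\<^esub> ext u (gen d' r')"
      using ud dr dr' u by (simp add: gen_mult ext_gen mult smult closed N.smult_assoc1)
  qed (use xy in auto)
qed (use xy in auto)

end

section \<open>2-crossed modules and their base change\<close>

text \<open>Wraps \<open>two_crossed_module\<close> so that its parameters for the components become
  the fields of \<open>X\<close>, and facts about different 2-crossed modules can be
  combined.\<close>

locale two_crossed =
  fixes K :: "'k ring" and X :: "('k, 'l, 'm, 'p) two_crossed"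
  assumes two_crossed_module: "two_crossed_module K X"

sublocale two_crossed \<subseteq> two_crossed_module K X "top_alg X" "mid_alg X" "base_alg X" "bdry2 X" "bdry1 X"
    "act_top X" "act_mid X" "lifting X"
  using two_crossed_module by simp_all

context two_crossed
begin

sublocale L: comm_alg K "top_alg X" by (rule alg_top)
sublocale M: comm_alg K "mid_alg X" by (rule alg_mid)
sublocale P: comm_alg K "base_alg X" by (rule alg_base)

declare L.mult_closed [simp, intro] M.mult_closed [simp, intro] P.mult_closed [simp, intro]

lemma bdry2_simps [simp]:
  "l \<in> carrier (top_alg X) \<Longrightarrow> bdry2 X l \<in> carrier (mid_alg X)"
  "\<lbrakk>l \<in> carrier (top_alg X); l' \<in> carrier (top_alg X)\<rbrakk> \<Longrightarrow>
    bdry2 X (l \<oplus>\<^bsub>top_alg X\<^esub> l') = bdry2 X l \<oplus>\<^bsub>mid_alg X\<^esub> bdry2 X l'"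
  "\<lbrakk>l \<in> carrier (top_alg X); l' \<in> carrier (top_alg X)\<rbrakk> \<Longrightarrow>
    bdry2 X (l \<otimes>\<^bsub>top_alg X\<^esub> l') = bdry2 X l \<otimes>\<^bsub>mid_alg X\<^esub> bdry2 X l'"
  "\<lbrakk>c \<in> carrier K; l \<in> carrier (top_alg X)\<rbrakk> \<Longrightarrow>
    bdry2 X (c \<odot>\<^bsub>top_alg X\<^esub> l) = c \<odot>\<^bsub>mid_alg X\<^esub> bdry2 X l"
  using hom2 by (auto simp: alg_hom_def)

lemma bdry1_simps [simp]:
  "m \<in> carrier (mid_alg X) \<Longrightarrow> bdry1 X m \<in> carrier (base_alg X)"
  "\<lbrakk>m \<in> carrier (mid_alg X); m' \<in> carrier (mid_alg X)\<rbrakk> \<Longrightarrow>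
    bdry1 X (m \<oplus>\<^bsub>mid_alg X\<^esub> m') = bdry1 X m \<oplus>\<^bsub>base_alg X\<^esub> bdry1 X m'"
  "\<lbrakk>m \<in> carrier (mid_alg X); m' \<in> carrier (mid_alg X)\<rbrakk> \<Longrightarrow>
    bdry1 X (m \<otimes>\<^bsub>mid_alg X\<^esub> m') = bdry1 X m \<otimes>\<^bsub>base_alg X\<^esub> bdry1 X m'"
  "\<lbrakk>c \<in> carrier K; m \<in> carrier (mid_alg X)\<rbrakk> \<Longrightarrow>
    bdry1 X (c \<odot>\<^bsub>mid_alg X\<^esub> m) = c \<odot>\<^bsub>base_alg X\<^esub> bdry1 X m"
  using hom1 by (auto simp: alg_hom_def)

lemma act_top_simps [simp]:
  "\<lbrakk>p \<in> carrier (base_alg X); l \<in> carrier (top_alg X)\<rbrakk> \<Longrightarrow> act_top X p l \<in> carrier (top_alg X)"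
  "\<lbrakk>p \<in> carrier (base_alg X); p' \<in> carrier (base_alg X); l \<in> carrier (top_alg X)\<rbrakk> \<Longrightarrow>
    act_top X (p \<oplus>\<^bsub>base_alg X\<^esub> p') l = act_top X p l \<oplus>\<^bsub>top_alg X\<^esub> act_top X p' l"
  "\<lbrakk>p \<in> carrier (base_alg X); l \<in> carrier (top_alg X); l' \<in> carrier (top_alg X)\<rbrakk> \<Longrightarrow>
    act_top X p (l \<oplus>\<^bsub>top_alg X\<^esub> l') = act_top X p l \<oplus>\<^bsub>top_alg X\<^esub> act_top X p l'"
  "\<lbrakk>p \<in> carrier (base_alg X); p' \<in> carrier (base_alg X); l \<in> carrier (top_alg X)\<rbrakk> \<Longrightarrow>
    act_top X (p \<otimes>\<^bsub>base_alg X\<^esub> p') l = act_top X p (act_top X p' l)"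
  "\<lbrakk>c \<in> carrier K; p \<in> carrier (base_alg X); l \<in> carrier (top_alg X)\<rbrakk> \<Longrightarrow>
    act_top X (c \<odot>\<^bsub>base_alg X\<^esub> p) l = c \<odot>\<^bsub>top_alg X\<^esub> act_top X p l"
  using action_top by (auto simp: alg_action_def bilinear_map_def)

lemma act_mid_simps [simp]:
  "\<lbrakk>p \<in> carrier (base_alg X); m \<in> carrier (mid_alg X)\<rbrakk> \<Longrightarrow> act_mid X p m \<in> carrier (mid_alg X)"
  "\<lbrakk>p \<in> carrier (base_alg X); p' \<in> carrier (base_alg X); m \<in> carrier (mid_alg X)\<rbrakk> \<Longrightarrow>
    act_mid X (p \<oplus>\<^bsub>base_alg X\<^esub> p') m = act_mid X p m \<oplus>\<^bsub>mid_alg X\<^esub> act_mid X p' m"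
  "\<lbrakk>p \<in> carrier (base_alg X); m \<in> carrier (mid_alg X); m' \<in> carrier (mid_alg X)\<rbrakk> \<Longrightarrow>
    act_mid X p (m \<oplus>\<^bsub>mid_alg X\<^esub> m') = act_mid X p m \<oplus>\<^bsub>mid_alg X\<^esub> act_mid X p m'"
  "\<lbrakk>p \<in> carrier (base_alg X); p' \<in> carrier (base_alg X); m \<in> carrier (mid_alg X)\<rbrakk> \<Longrightarrow>
    act_mid X (p \<otimes>\<^bsub>base_alg X\<^esub> p') m = act_mid X p (act_mid X p' m)"
  "\<lbrakk>c \<in> carrier K; p \<in> carrier (base_alg X); m \<in> carrier (mid_alg X)\<rbrakk> \<Longrightarrow>
    act_mid X (c \<odot>\<^bsub>base_alg X\<^esub> p) m = c \<odot>\<^bsub>mid_alg X\<^esub> act_mid X p m"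
  using action_mid by (auto simp: alg_action_def bilinear_map_def)

lemma lifting_simps [simp]:
  "\<lbrakk>m \<in> carrier (mid_alg X); n \<in> carrier (mid_alg X)\<rbrakk> \<Longrightarrow> lifting X m n \<in> carrier (top_alg X)"
  "\<lbrakk>m \<in> carrier (mid_alg X); m' \<in> carrier (mid_alg X); n \<in> carrier (mid_alg X)\<rbrakk> \<Longrightarrow>
    lifting X (m \<oplus>\<^bsub>mid_alg X\<^esub> m') n = lifting X m n \<oplus>\<^bsub>top_alg X\<^esub> lifting X m' n"
  "\<lbrakk>m \<in> carrier (mid_alg X); n \<in> carrier (mid_alg X); n' \<in> carrier (mid_alg X)\<rbrakk> \<Longrightarrow>
    lifting X m (n \<oplus>\<^bsub>mid_alg X\<^esub> n') = lifting X m n \<oplus>\<^bsub>top_alg X\<^esub> lifting X m n'"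
  "\<lbrakk>c \<in> carrier K; m \<in> carrier (mid_alg X); n \<in> carrier (mid_alg X)\<rbrakk> \<Longrightarrow>
    lifting X (c \<odot>\<^bsub>mid_alg X\<^esub> m) n = c \<odot>\<^bsub>top_alg X\<^esub> lifting X m n"
  "\<lbrakk>c \<in> carrier K; m \<in> carrier (mid_alg X); n \<in> carrier (mid_alg X)\<rbrakk> \<Longrightarrow>
    lifting X m (c \<odot>\<^bsub>mid_alg X\<^esub> n) = c \<odot>\<^bsub>top_alg X\<^esub> lifting X m n"
  using lifting_bilinear by (auto simp: bilinear_map_def)

lemma act_zero [simp]:
  "l \<in> carrier (top_alg X) \<Longrightarrow> act_top X \<zero>\<^bsub>base_alg X\<^esub> l = \<zero>\<^bsub>top_alg X\<^esub>"
  "m \<in> carrier (mid_alg X) \<Longrightarrow> act_mid X \<zero>\<^bsub>base_alg X\<^esub> m = \<zero>\<^bsub>mid_alg X\<^esub>"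
  using act_top_simps(5)[of "\<zero>\<^bsub>K\<^esub>" "\<zero>\<^bsub>base_alg X\<^esub>" l] act_mid_simps(5)[of "\<zero>\<^bsub>K\<^esub>" "\<zero>\<^bsub>base_alg X\<^esub>" m]
  by simp_all

text \<open>In \<open>PL3\<close>, and likewise in \<open>PL1\<close> for the next lemma, the
  correction term vanishes when the last argument is a boundary, since the composite of the
  boundaries is zero.\<close>

lemma lifting_mult_bdry2:
  assumes "m \<in> carrier (mid_alg X)" "l \<in> carrier (top_alg X)" "n \<in> carrier (mid_alg X)"
  shows "lifting X n (m \<otimes>\<^bsub>mid_alg X\<^esub> bdry2 X l) = lifting X (n \<otimes>\<^bsub>mid_alg X\<^esub> m) (bdry2 X l)"
  using assms PL3[of n m "bdry2 X l"] complex[of l] by simp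

lemma bdry2_lifting_bdry2:
  assumes "m \<in> carrier (mid_alg X)" "l \<in> carrier (top_alg X)"
  shows "bdry2 X (lifting X m (bdry2 X l)) = m \<otimes>\<^bsub>mid_alg X\<^esub> bdry2 X l"
  using assms PL1[of m "bdry2 X l"] complex[of l] by (simp add: M.minus_eq)

text \<open>With \<open>d\<close> for the second boundary:
  \<open>{m, d(l l')} = {m d(l), d(l')} = {d{m, d(l)}, d(l')}\<close>, which is
  \<open>{m, d(l)} l'\<close> by \<open>PL2\<close>. Similarly
  \<open>{m m', d(l)} = {m, m' d(l)} = {m, d{m', d(l)}}\<close>.\<close>

lemma lifting_action:
  "alg_action K (mid_alg X) (top_alg X) (\<lambda>m l. lifting X m (bdry2 X l))"
proof -
  have "lifting X m (bdry2 X (l \<otimes>\<^bsub>top_alg X\<^esub> l')) = lifting X m (bdry2 X l) \<otimes>\<^bsub>top_alg X\<^esub> l'"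
    if "m \<in> carrier (mid_alg X)" "l \<in> carrier (top_alg X)" "l' \<in> carrier (top_alg X)" for m l l'
    using that PL2[of "lifting X m (bdry2 X l)" l']
    by (simp add: lifting_mult_bdry2 bdry2_lifting_bdry2)
  moreover have "lifting X (m \<otimes>\<^bsub>mid_alg X\<^esub> m') (bdry2 X l) =
      lifting X m (bdry2 X (lifting X m' (bdry2 X l)))"
    if "m \<in> carrier (mid_alg X)" "m' \<in> carrier (mid_alg X)" "l \<in> carrier (top_alg X)" for m m' l
    using that by (simp add: lifting_mult_bdry2 bdry2_lifting_bdry2)
  ultimately show ?thesis
    by (simp add: alg_action_def bilinear_map_def)
qed

text \<open>Turns the algebras of any 2-crossed module over \<open>R\<close> into targets of
  \<open>ext\<close>. Here \<open>unital_top\<close> and \<open>unital_mid\<close> supply the axiom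
  that \<open>1\<close> acts as the identity.\<close>

lemma modules_over_base:
  assumes "algebra K R" and base: "base_alg X = R"
  shows "module R (with_smult (top_alg X) (act_top X))"
    and "module R (with_smult (mid_alg X) (act_mid X))"
proof -
  interpret R: cring R using assms(1) by (rule algebra.M_cring)
  have "is_identity (base_alg X) \<one>\<^bsub>R\<^esub>"
    by (simp add: is_identity_def base)
  then have one: "l \<in> carrier (top_alg X) \<Longrightarrow> act_top X \<one>\<^bsub>R\<^esub> l = l"
      "m \<in> carrier (mid_alg X) \<Longrightarrow> act_mid X \<one>\<^bsub>R\<^esub> m = m" for l m
    by (auto intro: unital_top unital_mid)
  show "module R (with_smult (top_alg X) (act_top X))"
    by (rule moduleI) (simp_all add: R.is_cring abelian_group_with_smult L.abelian_group_axioms one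
        act_top_simps[unfolded base])
  show "module R (with_smult (mid_alg X) (act_mid X))"
    by (rule moduleI) (simp_all add: R.is_cring abelian_group_with_smult M.abelian_group_axioms one
        act_mid_simps[unfolded base])
qed

end

section \<open>Structure maps on the base change of a 2-crossed module\<close>

locale two_crossed_base_change = R: algebra K R + D: two_crossed K D
  for K :: "'k ring" and R :: "('k, 'r) module" and D :: "('k, 'l, 'm, 's) two_crossed" +
  fixes phi :: "'s \<Rightarrow> 'r"
  assumes phi: "alg_hom K (base_alg D) R phi"
begin

sublocale M: base_change K R "base_alg D" "mid_alg D" phi "act_mid D"
  by unfold_locales (use phi D.action_mid in auto)

sublocale L: base_change K R "base_alg D" "top_alg D" phi "act_top D"
  by unfold_locales (use phi D.action_top in auto)

text \<open>The targets needed: the second boundary takes values in the base-changed middle algebra,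
  the lifting in the base-changed top algebra, and the first boundary in \<open>R\<close> as a
  module over itself.\<close>

sublocale Bdry2: base_change_target K R "base_alg D" "top_alg D" phi "act_top D" "M.P.A" ..
sublocale Lift: base_change_target K R "base_alg D" "mid_alg D" phi "act_mid D" "L.P.A" ..

lemma module_self: "module R (with_smult R (monoid.mult R))"
  by (rule moduleI)
    (auto simp: R.M_cring R.l_distr R.r_distr R.m_assoc
      intro: abelian_group_with_smult R.abelian_group_axioms)

abbreviation R_self where "R_self \<equiv> with_smult R (monoid.mult R)"

sublocale Bdry1: base_change_target K R "base_alg D" "mid_alg D" phi "act_mid D" R_self
  by (intro base_change_target.intro M.base_change_axioms module_self)

lemma semilinear_bdry2: "L.semilinear M.P.A (\<lambda>l. M.gen (bdry2 D l) \<one>\<^bsub>R\<^esub>)"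
  by (auto simp: L.semilinear_def M.gen_add D.equivariant2 M.gen_balance M.gen_scalar M.gen_act)

lemma semilinear_bdry1: "M.semilinear R_self (\<lambda>m. phi (bdry1 D m))"
proof -
  have "c \<odot>\<^bsub>R\<^esub> phi s = (c \<odot>\<^bsub>R\<^esub> \<one>\<^bsub>R\<^esub>) \<otimes>\<^bsub>R\<^esub> phi s"
    if "c \<in> carrier K" "s \<in> carrier (base_alg D)" for c s
    using that R.smult_assoc2[of c "\<one>\<^bsub>R\<^esub>" "phi s"] by simp
  then show ?thesis
    using phi by (auto simp: M.semilinear_def alg_hom_def D.equivariant1)
qed

text \<open>\<open>PL5a\<close> and \<open>PL5b\<close> pull the action of \<open>s\<close> out of
  the lifting, and \<open>gen_balance\<close> turns it into the scalar \<open>phi s\<close>.\<close>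

lemma semilinear_lifting:
  assumes "m \<in> carrier (mid_alg D)"
  shows "M.semilinear L.P.A (\<lambda>n. L.gen (lifting D n m) \<one>\<^bsub>R\<^esub>)"
    and "M.semilinear L.P.A (\<lambda>n. L.gen (lifting D m n) \<one>\<^bsub>R\<^esub>)"
  using assms
  by (auto simp: M.semilinear_def L.gen_add L.gen_balance L.gen_scalar L.gen_act
      simp flip: D.PL5a D.PL5b)

text \<open>The maps being extended are the prescribed formulas at \<open>r = 1\<close>; linearity
  over \<open>R\<close> then gives the formulas for all \<open>r\<close>.\<close>

abbreviation bd2 where "bd2 \<equiv> Bdry2.ext (\<lambda>l. M.gen (bdry2 D l) \<one>\<^bsub>R\<^esub>)"
abbreviation bd1 where "bd1 \<equiv> Bdry1.ext (\<lambda>m. phi (bdry1 D m))"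
abbreviation lift where "lift \<equiv> Lift.bil (\<lambda>m n. L.gen (lifting D m n) \<one>\<^bsub>R\<^esub>)"

lemma bd2_simps [simp]:
  "x \<in> carrier L.P.A \<Longrightarrow> bd2 x \<in> carrier M.P.A"
  "\<lbrakk>x \<in> carrier L.P.A; y \<in> carrier L.P.A\<rbrakk> \<Longrightarrow> bd2 (x \<oplus>\<^bsub>L.P.A\<^esub> y) = bd2 x \<oplus>\<^bsub>M.P.A\<^esub> bd2 y"
  "\<lbrakk>a \<in> carrier R; x \<in> carrier L.P.A\<rbrakk> \<Longrightarrow> bd2 (a \<odot>\<^bsub>L.P.A\<^esub> x) = a \<odot>\<^bsub>M.P.A\<^esub> bd2 x"
  "\<lbrakk>l \<in> carrier (top_alg D); r \<in> carrier R\<rbrakk> \<Longrightarrow> bd2 (L.gen l r) = M.gen (bdry2 D l) r"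
  using semilinear_bdry2 by (auto simp: Bdry2.ext_add Bdry2.ext_smult Bdry2.ext_gen M.gen_act)

lemma bd2_mult [simp]:
  "\<lbrakk>x \<in> carrier L.P.A; y \<in> carrier L.P.A\<rbrakk> \<Longrightarrow> bd2 (x \<otimes>\<^bsub>L.P.A\<^esub> y) = bd2 x \<otimes>\<^bsub>M.P.A\<^esub> bd2 y"
  by (rule Bdry2.ext_mult[OF semilinear_bdry2])
    (simp_all add: M.P.mult_distr_A M.P.smult_mult_A M.gen_mult, rule M.P.mult_comm_A)

lemma bd1_simps [simp]:
  "x \<in> carrier M.P.A \<Longrightarrow> bd1 x \<in> carrier R"
  "\<lbrakk>x \<in> carrier M.P.A; y \<in> carrier M.P.A\<rbrakk> \<Longrightarrow> bd1 (x \<oplus>\<^bsub>M.P.A\<^esub> y) = bd1 x \<oplus>\<^bsub>R\<^esub> bd1 y"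
  "\<lbrakk>a \<in> carrier R; x \<in> carrier M.P.A\<rbrakk> \<Longrightarrow> bd1 (a \<odot>\<^bsub>M.P.A\<^esub> x) = a \<otimes>\<^bsub>R\<^esub> bd1 x"
  "\<lbrakk>m \<in> carrier (mid_alg D); r \<in> carrier R\<rbrakk> \<Longrightarrow> bd1 (M.gen m r) = phi (bdry1 D m) \<otimes>\<^bsub>R\<^esub> r"
  using semilinear_bdry1 Bdry1.ext_closed[OF semilinear_bdry1, of x]
  by (auto simp: Bdry1.ext_add Bdry1.ext_smult Bdry1.ext_gen R.m_comm)

lemma bd1_mult [simp]:
  assumes "x \<in> carrier M.P.A" "y \<in> carrier M.P.A"
  shows "bd1 (x \<otimes>\<^bsub>M.P.A\<^esub> y) = bd1 x \<otimes>\<^bsub>R\<^esub> bd1 y"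
proof -
  have "bd1 (x \<otimes>\<^bsub>M.P.A\<^esub> y) = bd1 x \<otimes>\<^bsub>R_self\<^esub> bd1 y"
    using phi assms
    by (intro Bdry1.ext_mult[OF semilinear_bdry1])
      (simp_all add: R.l_distr R.m_assoc alg_hom_def, rule R.m_comm)
  then show ?thesis by simp
qed

lemma lift_simps [simp]:
  "\<lbrakk>x \<in> carrier M.P.A; y \<in> carrier M.P.A\<rbrakk> \<Longrightarrow> lift x y \<in> carrier L.P.A"
  "\<lbrakk>x \<in> carrier M.P.A; x' \<in> carrier M.P.A; y \<in> carrier M.P.A\<rbrakk> \<Longrightarrow>
    lift (x \<oplus>\<^bsub>M.P.A\<^esub> x') y = lift x y \<oplus>\<^bsub>L.P.A\<^esub> lift x' y"
  "\<lbrakk>a \<in> carrier R; x \<in> carrier M.P.A; y \<in> carrier M.P.A\<rbrakk> \<Longrightarrow>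
    lift (a \<odot>\<^bsub>M.P.A\<^esub> x) y = a \<odot>\<^bsub>L.P.A\<^esub> lift x y"
  "\<lbrakk>x \<in> carrier M.P.A; y \<in> carrier M.P.A; y' \<in> carrier M.P.A\<rbrakk> \<Longrightarrow>
    lift x (y \<oplus>\<^bsub>M.P.A\<^esub> y') = lift x y \<oplus>\<^bsub>L.P.A\<^esub> lift x y'"
  "\<lbrakk>a \<in> carrier R; x \<in> carrier M.P.A; y \<in> carrier M.P.A\<rbrakk> \<Longrightarrow>
    lift x (a \<odot>\<^bsub>M.P.A\<^esub> y) = a \<odot>\<^bsub>L.P.A\<^esub> lift x y"
  "\<lbrakk>m \<in> carrier (mid_alg D); n \<in> carrier (mid_alg D); r \<in> carrier R; q \<in> carrier R\<rbrakk> \<Longrightarrow>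
    lift (M.gen m r) (M.gen n q) = L.gen (lifting D m n) (r \<otimes>\<^bsub>R\<^esub> q)"
  by (simp_all add: semilinear_lifting Lift.bil_closed Lift.bil_add_left Lift.bil_smult_left
      Lift.bil_add_right Lift.bil_smult_right Lift.bil_gen L.gen_act)

section \<open>The presented algebras are the base changes\<close>

lemma alg_cong_mid: "alg_cong R (carrier (mid_alg D) \<times> carrier R) (mid_rels K R D phi) = M.P.C"
  unfolding mid_rels_def by (rule M.cong_diff_rels)

lemma mid_algR_eq: "mid_algR K R D phi = M.P.A"
  unfolding mid_algR_def by (rule presented_algebra_cong[OF alg_cong_mid])

lemma mid_gen_eq: "mid_gen K R D phi d r = M.gen d r"
  unfolding mid_gen_def M.gen_def alg_cong_mid ..

lemmas mid_eqs = mid_algR_eq mid_gen_eq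

text \<open>
  The relations \<open>lift_rels\<close> hold already in the base change of the top algebra, because the Peiffer
  lifting of \<open>D\<close> extends to it.
\<close>

lemma lift_rels_redundant: "lift_rels K R D phi \<subseteq> L.P.C"
proof -
  have congI: "(Gen (l, r), Add (Gen (l', r')) (Gen (l'', r''))) \<in> L.P.C"
    if "L.gen l r = L.gen l' r' \<oplus>\<^bsub>L.P.A\<^esub> L.gen l'' r''"
      and "{l, l', l''} \<subseteq> carrier (top_alg D)" "{r, r', r''} \<subseteq> carrier R" for l r l' r' l'' r''
  proof -
    have "L.P.cls (Gen (l, r)) = L.P.cls (Add (Gen (l', r')) (Gen (l'', r'')))"
      using that by (simp add: L.gen_def L.P.cls_ops L.P.term_intros)
    then show ?thesis
      using that(2,3) by (subst L.P.cls_eq_iff[symmetric]) (auto intro: alg_terms.intros)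
  qed
  have left: "(Gen (lifting D e d'', q \<otimes>\<^bsub>R\<^esub> r''),
      Add (Gen (lifting D d d'', r \<otimes>\<^bsub>R\<^esub> r'')) (Gen (lifting D d' d'', r' \<otimes>\<^bsub>R\<^esub> r''))) \<in> L.P.C"
    if "{e, d, d', d''} \<subseteq> carrier (mid_alg D)" "{q, r, r', r''} \<subseteq> carrier R"
      "M.gen e q = M.gen d r \<oplus>\<^bsub>M.P.A\<^esub> M.gen d' r'" for e q d r d' r' d'' r''
    using that lift_simps(6)[of e d'' q r''] by (intro congI) simp_all
  have right: "(Gen (lifting D d e, r \<otimes>\<^bsub>R\<^esub> q),
      Add (Gen (lifting D d d', r \<otimes>\<^bsub>R\<^esub> r')) (Gen (lifting D d d'', r \<otimes>\<^bsub>R\<^esub> r''))) \<in> L.P.C"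
    if "{e, d, d', d''} \<subseteq> carrier (mid_alg D)" "{q, r, r', r''} \<subseteq> carrier R"
      "M.gen e q = M.gen d' r' \<oplus>\<^bsub>M.P.A\<^esub> M.gen d'' r''" for e q d r d' r' d'' r''
    using that lift_simps(6)[of d e r q] by (intro congI) simp_all
  show ?thesis
    unfolding lift_rels_def mid_eqs
    by (intro subsetI, elim UnE CollectE exE conjE) (simp_all only: left right)
qed

lemma alg_cong_top: "alg_cong R (carrier (top_alg D) \<times> carrier R) (top_rels K R D phi) = L.P.C"
proof (intro equalityI alg_cong_least)
  fix t u assume tu: "(t, u) \<in> top_rels K R D phi" "t \<in> L.P.T" "u \<in> L.P.T"
  then consider "(t, u) \<in> lift_rels K R D phi" | "(t, u) \<in> L.rels"
    unfolding top_rels_def base_change_rels_def by blast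
  then show "(t, u) \<in> L.P.C"
    using tu by cases (use lift_rels_redundant in \<open>auto intro: alg_cong.rel\<close>)
next
  fix t u assume "(t, u) \<in> L.rels" "t \<in> L.P.T" "u \<in> L.P.T"
  then show "(t, u) \<in> alg_cong R (carrier (top_alg D) \<times> carrier R) (top_rels K R D phi)"
    by (intro alg_cong.rel) (auto simp: top_rels_def base_change_rels_def)
qed

lemma top_algR_eq: "top_algR K R D phi = L.P.A"
  unfolding top_algR_def by (rule presented_algebra_cong[OF alg_cong_top])

lemma top_gen_eq: "top_gen K R D phi d r = L.gen d r"
  unfolding top_gen_def L.gen_def alg_cong_top ..

lemmas top_eqs = top_algR_eq top_gen_eq

lemmas linear_simps =
  M.P.mult_distr_A M.P.mult_distr_right_A M.P.A.smult_l_distr M.P.A.smult_r_distr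
  L.P.mult_distr_A L.P.mult_distr_right_A L.P.A.smult_l_distr L.P.A.smult_r_distr
  M.P.A.M.minus_eq L.P.A.M.minus_eq M.P.A.M.minus_add L.P.A.M.minus_add
  M.P.A.M.a_ac L.P.A.M.a_ac

section \<open>The axioms of a 2-crossed module for the base change\<close>

lemma bd1_bd2:
  assumes "x \<in> carrier L.P.A"
  shows "bd1 (bd2 x) = \<zero>\<^bsub>R\<^esub>"
proof (rule L.additive_eqI[OF R.abelian_group_axioms, where F = "\<lambda>x. bd1 (bd2 x)"])
  fix l r assume "l \<in> carrier (top_alg D)" "r \<in> carrier R"
  moreover have "phi \<zero>\<^bsub>base_alg D\<^esub> = \<zero>\<^bsub>R\<^esub>"
    by (rule alg_hom_zero[OF D.alg_base algebra_comm_alg[OF R.algebra_axioms] phi])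
  ultimately show "bd1 (bd2 (L.gen l r)) = \<zero>\<^bsub>R\<^esub>"
    by (simp add: D.complex)
qed (use assms in \<open>auto simp: additive_map_def\<close>)

text \<open>The pattern for all axioms in several variables: \<open>additive_eqI\<close> is applied
  to one variable after another, the earlier ones being generators by then. On generators the axiom
  of \<open>D\<close> remains, with the product of the scalars in the second component.\<close>

lemma bd2_lift:
  assumes x: "x \<in> carrier M.P.A" and y: "y \<in> carrier M.P.A"
  shows "bd2 (lift x y) = x \<otimes>\<^bsub>M.P.A\<^esub> y \<ominus>\<^bsub>M.P.A\<^esub> bd1 y \<odot>\<^bsub>M.P.A\<^esub> x"
proof (rule M.additive_eqI[OF M.P.A.M.abelian_group_axioms, where x = x])
  fix m r assume m: "m \<in> carrier (mid_alg D)" "r \<in> carrier R"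
  show "bd2 (lift (M.gen m r) y) = M.gen m r \<otimes>\<^bsub>M.P.A\<^esub> y \<ominus>\<^bsub>M.P.A\<^esub> bd1 y \<odot>\<^bsub>M.P.A\<^esub> M.gen m r"
  proof (rule M.additive_eqI[OF M.P.A.M.abelian_group_axioms, where x = y])
    fix n q assume n: "n \<in> carrier (mid_alg D)" "q \<in> carrier R"
    \<comment> \<open>The correction term of \<open>PL1\<close>: the action of the boundary of
      \<open>n\<close> moves across to \<open>R\<close>, where together with \<open>q\<close> it is
      the scalar \<open>bd1 (M.gen n q)\<close>.\<close>
    have "M.gen (act_mid D (bdry1 D n) m) (r \<otimes>\<^bsub>R\<^esub> q) = (phi (bdry1 D n) \<otimes>\<^bsub>R\<^esub> q) \<odot>\<^bsub>M.P.A\<^esub> M.gen m r"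
      using m n by (simp add: M.gen_balance M.gen_act R.m_ac)
    then show "bd2 (lift (M.gen m r) (M.gen n q)) =
        M.gen m r \<otimes>\<^bsub>M.P.A\<^esub> M.gen n q \<ominus>\<^bsub>M.P.A\<^esub> bd1 (M.gen n q) \<odot>\<^bsub>M.P.A\<^esub> M.gen m r"
      using m n by (simp add: D.PL1 M.gen_minus M.gen_mult)
  qed (use m y in \<open>auto simp: additive_map_def linear_simps\<close>)
qed (use x y in \<open>auto simp: additive_map_def linear_simps\<close>)

lemma lift_bd2_bd2:
  assumes x: "x \<in> carrier L.P.A" and y: "y \<in> carrier L.P.A"
  shows "lift (bd2 x) (bd2 y) = x \<otimes>\<^bsub>L.P.A\<^esub> y"
proof (rule L.additive_eqI[OF L.P.A.M.abelian_group_axioms, where x = x])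
  fix l r assume l: "l \<in> carrier (top_alg D)" "r \<in> carrier R"
  show "lift (bd2 (L.gen l r)) (bd2 y) = L.gen l r \<otimes>\<^bsub>L.P.A\<^esub> y"
  proof (rule L.additive_eqI[OF L.P.A.M.abelian_group_axioms, where x = y])
    fix l' q assume "l' \<in> carrier (top_alg D)" "q \<in> carrier R"
    then show "lift (bd2 (L.gen l r)) (bd2 (L.gen l' q)) = L.gen l r \<otimes>\<^bsub>L.P.A\<^esub> L.gen l' q"
      using l by (simp add: D.PL2 L.gen_mult)
  qed (use l y in \<open>auto simp: additive_map_def linear_simps\<close>)
qed (use x y in \<open>auto simp: additive_map_def linear_simps\<close>)

lemma lift_mult:
  assumes x: "x \<in> carrier M.P.A" and y: "y \<in> carrier M.P.A" and z: "z \<in> carrier M.P.A"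
  shows "lift x (y \<otimes>\<^bsub>M.P.A\<^esub> z) = lift (x \<otimes>\<^bsub>M.P.A\<^esub> y) z \<oplus>\<^bsub>L.P.A\<^esub> bd1 z \<odot>\<^bsub>L.P.A\<^esub> lift x y"
proof (rule M.additive_eqI[OF L.P.A.M.abelian_group_axioms, where x = x])
  fix m r assume m: "m \<in> carrier (mid_alg D)" "r \<in> carrier R"
  show "lift (M.gen m r) (y \<otimes>\<^bsub>M.P.A\<^esub> z) =
    lift (M.gen m r \<otimes>\<^bsub>M.P.A\<^esub> y) z \<oplus>\<^bsub>L.P.A\<^esub> bd1 z \<odot>\<^bsub>L.P.A\<^esub> lift (M.gen m r) y"
  proof (rule M.additive_eqI[OF L.P.A.M.abelian_group_axioms, where x = y])
    fix n q assume n: "n \<in> carrier (mid_alg D)" "q \<in> carrier R"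
    show "lift (M.gen m r) (M.gen n q \<otimes>\<^bsub>M.P.A\<^esub> z) =
      lift (M.gen m r \<otimes>\<^bsub>M.P.A\<^esub> M.gen n q) z \<oplus>\<^bsub>L.P.A\<^esub> bd1 z \<odot>\<^bsub>L.P.A\<^esub> lift (M.gen m r) (M.gen n q)"
    proof (rule M.additive_eqI[OF L.P.A.M.abelian_group_axioms, where x = z])
      fix p a assume p: "p \<in> carrier (mid_alg D)" "a \<in> carrier R"
      show "lift (M.gen m r) (M.gen n q \<otimes>\<^bsub>M.P.A\<^esub> M.gen p a) =
        lift (M.gen m r \<otimes>\<^bsub>M.P.A\<^esub> M.gen n q) (M.gen p a) \<oplus>\<^bsub>L.P.A\<^esub>
        bd1 (M.gen p a) \<odot>\<^bsub>L.P.A\<^esub> lift (M.gen m r) (M.gen n q)"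
        using m n p by (simp add: M.gen_mult D.PL3 L.gen_add L.gen_balance L.gen_act R.m_ac)
    qed (use m n z in \<open>auto simp: additive_map_def linear_simps\<close>)
  qed (use m y z in \<open>auto simp: additive_map_def linear_simps\<close>)
qed (use x y z in \<open>auto simp: additive_map_def linear_simps\<close>)

lemma lift_bd2_diff:
  assumes x: "x \<in> carrier M.P.A" and y: "y \<in> carrier L.P.A"
  shows "lift x (bd2 y) \<ominus>\<^bsub>L.P.A\<^esub> lift (bd2 y) x = bd1 x \<odot>\<^bsub>L.P.A\<^esub> y"
proof (rule M.additive_eqI[OF L.P.A.M.abelian_group_axioms, where x = x])
  fix m r assume m: "m \<in> carrier (mid_alg D)" "r \<in> carrier R"
  show "lift (M.gen m r) (bd2 y) \<ominus>\<^bsub>L.P.A\<^esub> lift (bd2 y) (M.gen m r) = bd1 (M.gen m r) \<odot>\<^bsub>L.P.A\<^esub> y"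
  proof (rule L.additive_eqI[OF L.P.A.M.abelian_group_axioms, where x = y])
    fix l q assume l: "l \<in> carrier (top_alg D)" "q \<in> carrier R"
    then show "lift (M.gen m r) (bd2 (L.gen l q)) \<ominus>\<^bsub>L.P.A\<^esub> lift (bd2 (L.gen l q)) (M.gen m r) =
        bd1 (M.gen m r) \<odot>\<^bsub>L.P.A\<^esub> L.gen l q"
      \<comment> \<open>Generators can be subtracted by \<open>gen_minus\<close> when their scalars
        agree, so \<open>q r\<close> is first rewritten as \<open>r q\<close>; then
        \<open>PL4\<close> applies in the first component.\<close>
      using m by (simp add: R.m_comm[of q r] L.gen_act R.m_assoc D.PL4
          flip: L.gen_minus L.gen_balance)
  qed (use m y in \<open>auto simp: additive_map_def linear_simps\<close>)
qed (use x y in \<open>auto simp: additive_map_def linear_simps\<close>)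

definition base_changed ::
  "('k, ('r, 'l \<times> 'r) alg_term set, ('r, 'm \<times> 'r) alg_term set, 'r) two_crossed" where
  "base_changed = \<lparr>top_alg = restrict_scalars R L.P.A, mid_alg = restrict_scalars R M.P.A, base_alg = R,
     bdry2 = bd2, bdry1 = bd1, act_top = smult L.P.A, act_mid = smult M.P.A, lifting = lift\<rparr>"

text \<open>\<open>unital_top\<close> and \<open>unital_mid\<close> speak of any identity element of
  the base, the module axioms of \<open>1\<close>.\<close>

lemma identity_eq:
  assumes "is_identity R e"
  shows "e = \<one>\<^bsub>R\<^esub>"
proof -
  interpret R': cring R by (rule R.M_cring)
  have "e \<in> carrier R" "e \<otimes>\<^bsub>R\<^esub> \<one>\<^bsub>R\<^esub> = \<one>\<^bsub>R\<^esub>"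
    using assms unfolding is_identity_def by blast+
  then show ?thesis by simp
qed

lemma two_crossed_module_base_changed: "two_crossed_module K base_changed"
  by (rule two_crossed_module.intro)
    (simp_all add: base_changed_def L.comm_alg_restrict M.comm_alg_restrict
      algebra_comm_alg[OF R.algebra_axioms] L.action_restrict M.action_restrict bd1_bd2 bd2_lift lift_bd2_bd2
      lift_mult lift_bd2_diff alg_hom_def bilinear_map_def L.scalar_mult Pi_iff
      M.P.A.M.minus_eq, auto dest!: identity_eq)

lemma presented_base_changed: "presented_two_crossed K R D phi base_changed"
  by (simp add: presented_two_crossed_def base_changed_def mid_eqs top_eqs M.gen_act L.gen_act)

end

section \<open>The universal property\<close>

text \<open>\<open>I\<close> is arbitrary: what is used of it are its values on generators and the
  additivity of its structure maps, which together determine these maps on the carriers.\<close>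

locale presented_base_change = two_crossed_base_change K R D phi + I: two_crossed K I
  for K :: "'k ring" and R :: "('k, 'r) module" and D :: "('k, 'l, 'm, 's) two_crossed"
    and phi :: "'s \<Rightarrow> 'r"
    and I :: "('k, ('r, 'l \<times> 'r) alg_term set, ('r, 'm \<times> 'r) alg_term set, 'r) two_crossed" +
  assumes presented: "presented_two_crossed K R D phi I"
begin

lemma algebras:
  "top_alg I = restrict_scalars R L.P.A" "mid_alg I = restrict_scalars R M.P.A" "base_alg I = R"
  using presented by (simp_all add: presented_two_crossed_def mid_eqs top_eqs)

lemma on_gens [simp]:
  "\<lbrakk>l \<in> carrier (top_alg D); r \<in> carrier R\<rbrakk> \<Longrightarrow> bdry2 I (L.gen l r) = M.gen (bdry2 D l) r"
  "\<lbrakk>m \<in> carrier (mid_alg D); r \<in> carrier R\<rbrakk> \<Longrightarrow> bdry1 I (M.gen m r) = phi (bdry1 D m) \<otimes>\<^bsub>R\<^esub> r"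
  "\<lbrakk>a \<in> carrier R; l \<in> carrier (top_alg D); r \<in> carrier R\<rbrakk> \<Longrightarrow>
    act_top I a (L.gen l r) = L.gen l (a \<otimes>\<^bsub>R\<^esub> r)"
  "\<lbrakk>a \<in> carrier R; m \<in> carrier (mid_alg D); r \<in> carrier R\<rbrakk> \<Longrightarrow>
    act_mid I a (M.gen m r) = M.gen m (a \<otimes>\<^bsub>R\<^esub> r)"
  "\<lbrakk>m \<in> carrier (mid_alg D); n \<in> carrier (mid_alg D); r \<in> carrier R; q \<in> carrier R\<rbrakk> \<Longrightarrow>
    lifting I (M.gen m r) (M.gen n q) = L.gen (lifting D m n) (r \<otimes>\<^bsub>R\<^esub> q)"
  using presented by (simp_all add: presented_two_crossed_def mid_eqs top_eqs)

lemmas I_simps [simp] =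
  I.bdry2_simps[unfolded algebras restrict_scalars_simps]
  I.bdry1_simps[unfolded algebras restrict_scalars_simps]
  I.act_top_simps[unfolded algebras restrict_scalars_simps]
  I.act_mid_simps[unfolded algebras restrict_scalars_simps]
  I.lifting_simps[unfolded algebras restrict_scalars_simps]

lemma hom_to_base_change:
  "two_crossed_hom K D I (\<lambda>l. L.gen l \<one>\<^bsub>R\<^esub>) (\<lambda>m. M.gen m \<one>\<^bsub>R\<^esub>) phi"
  using phi
  by (simp add: two_crossed_hom_def alg_hom_def algebras Pi_iff L.gen_add M.gen_add L.gen_mult M.gen_mult
      L.gen_scalar M.gen_scalar L.gen_balance M.gen_balance L.gen_act M.gen_act)

end

section \<open>Factorization of a morphism through the base change\<close>

locale base_change_factorization = presented_base_change K R D phi I + Y: two_crossed K Y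
  for K :: "'k ring" and R :: "('k, 'r) module" and D :: "('k, 'l, 'm, 's) two_crossed"
    and phi :: "'s \<Rightarrow> 'r"
    and I :: "('k, ('r, 'l \<times> 'r) alg_term set, ('r, 'm \<times> 'r) alg_term set, 'r) two_crossed"
    and Y :: "('k, 'b2, 'b1, 'r) two_crossed" +
  fixes f2 :: "'l \<Rightarrow> 'b2" and f1 :: "'m \<Rightarrow> 'b1"
  assumes base: "base_alg Y = R" and hom: "two_crossed_hom K D Y f2 f1 phi"
begin

abbreviation Y2 where "Y2 \<equiv> with_smult (top_alg Y) (act_top Y)"
abbreviation Y1 where "Y1 \<equiv> with_smult (mid_alg Y) (act_mid Y)"

sublocale Y2: base_change_target K R "base_alg D" "top_alg D" phi "act_top D" Y2
  by (intro base_change_target.intro L.base_change_axioms Y.modules_over_base R.algebra_axioms base)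

sublocale Y1: base_change_target K R "base_alg D" "mid_alg D" phi "act_mid D" Y1
  by (intro base_change_target.intro M.base_change_axioms Y.modules_over_base R.algebra_axioms base)

lemmas Y_simps [simp] =
  Y.bdry1_simps[unfolded base] Y.act_top_simps[unfolded base] Y.act_mid_simps[unfolded base]

lemma act_one [simp]:
  "l \<in> carrier (top_alg Y) \<Longrightarrow> act_top Y \<one>\<^bsub>R\<^esub> l = l"
  "m \<in> carrier (mid_alg Y) \<Longrightarrow> act_mid Y \<one>\<^bsub>R\<^esub> m = m"
  using Y2.N.smult_one[of l] Y1.N.smult_one[of m] by simp_all

lemma f_simps [simp]:
  "l \<in> carrier (top_alg D) \<Longrightarrow> f2 l \<in> carrier (top_alg Y)"
  "m \<in> carrier (mid_alg D) \<Longrightarrow> f1 m \<in> carrier (mid_alg Y)"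
  "\<lbrakk>l \<in> carrier (top_alg D); l' \<in> carrier (top_alg D)\<rbrakk> \<Longrightarrow>
    f2 (l \<otimes>\<^bsub>top_alg D\<^esub> l') = f2 l \<otimes>\<^bsub>top_alg Y\<^esub> f2 l'"
  "\<lbrakk>m \<in> carrier (mid_alg D); m' \<in> carrier (mid_alg D)\<rbrakk> \<Longrightarrow>
    f1 (m \<otimes>\<^bsub>mid_alg D\<^esub> m') = f1 m \<otimes>\<^bsub>mid_alg Y\<^esub> f1 m'"
  "m \<in> carrier (mid_alg D) \<Longrightarrow> bdry1 Y (f1 m) = phi (bdry1 D m)"
  "l \<in> carrier (top_alg D) \<Longrightarrow> bdry2 Y (f2 l) = f1 (bdry2 D l)"
  "\<lbrakk>m \<in> carrier (mid_alg D); m' \<in> carrier (mid_alg D)\<rbrakk> \<Longrightarrow>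
    lifting Y (f1 m) (f1 m') = f2 (lifting D m m')"
  using hom by (auto simp: two_crossed_hom_def alg_hom_def)

text \<open>A morphism lying over \<open>phi\<close> turns the action of \<open>s\<close> into that
  of \<open>phi s\<close>. On \<open>Y\<close> a scalar \<open>c\<close> of \<open>K\<close> acts as
  \<open>c 1\<close> in \<open>R\<close> does, because \<open>1\<close> acts as the
  identity.\<close>

lemma semilinear_f:
  "L.semilinear Y2 f2" "M.semilinear Y1 f1"
  using hom
  by (auto simp: L.semilinear_def M.semilinear_def two_crossed_hom_def alg_hom_def)

abbreviation g2 where "g2 \<equiv> Y2.ext f2"
abbreviation g1 where "g1 \<equiv> Y1.ext f1"

lemma g2_simps [simp]:
  "x \<in> carrier L.P.A \<Longrightarrow> g2 x \<in> carrier (top_alg Y)"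
  "\<lbrakk>x \<in> carrier L.P.A; y \<in> carrier L.P.A\<rbrakk> \<Longrightarrow> g2 (x \<oplus>\<^bsub>L.P.A\<^esub> y) = g2 x \<oplus>\<^bsub>top_alg Y\<^esub> g2 y"
  "\<lbrakk>a \<in> carrier R; x \<in> carrier L.P.A\<rbrakk> \<Longrightarrow> g2 (a \<odot>\<^bsub>L.P.A\<^esub> x) = act_top Y a (g2 x)"
  "\<lbrakk>l \<in> carrier (top_alg D); r \<in> carrier R\<rbrakk> \<Longrightarrow> g2 (L.gen l r) = act_top Y r (f2 l)"
  using semilinear_f Y2.ext_closed[of f2 x]
  by (simp_all add: Y2.ext_add Y2.ext_smult Y2.ext_gen)

lemma g1_simps [simp]:
  "x \<in> carrier M.P.A \<Longrightarrow> g1 x \<in> carrier (mid_alg Y)"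
  "\<lbrakk>x \<in> carrier M.P.A; y \<in> carrier M.P.A\<rbrakk> \<Longrightarrow> g1 (x \<oplus>\<^bsub>M.P.A\<^esub> y) = g1 x \<oplus>\<^bsub>mid_alg Y\<^esub> g1 y"
  "\<lbrakk>a \<in> carrier R; x \<in> carrier M.P.A\<rbrakk> \<Longrightarrow> g1 (a \<odot>\<^bsub>M.P.A\<^esub> x) = act_mid Y a (g1 x)"
  "\<lbrakk>m \<in> carrier (mid_alg D); r \<in> carrier R\<rbrakk> \<Longrightarrow> g1 (M.gen m r) = act_mid Y r (f1 m)"
  using semilinear_f Y1.ext_closed[of f1 x]
  by (simp_all add: Y1.ext_add Y1.ext_smult Y1.ext_gen)

lemma act_mult_Y:
  "\<lbrakk>a \<in> carrier R; l \<in> carrier (top_alg Y); l' \<in> carrier (top_alg Y)\<rbrakk> \<Longrightarrow>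
    act_top Y a l \<otimes>\<^bsub>top_alg Y\<^esub> l' = act_top Y a (l \<otimes>\<^bsub>top_alg Y\<^esub> l')"
  "\<lbrakk>a \<in> carrier R; m \<in> carrier (mid_alg Y); m' \<in> carrier (mid_alg Y)\<rbrakk> \<Longrightarrow>
    act_mid Y a m \<otimes>\<^bsub>mid_alg Y\<^esub> m' = act_mid Y a (m \<otimes>\<^bsub>mid_alg Y\<^esub> m')"
  using Y.action_top Y.action_mid by (auto simp: alg_action_def base)

lemma g2_mult:
  assumes "x \<in> carrier L.P.A" "y \<in> carrier L.P.A"
  shows "g2 (x \<otimes>\<^bsub>L.P.A\<^esub> y) = g2 x \<otimes>\<^bsub>top_alg Y\<^esub> g2 y"
proof -
  have "g2 (x \<otimes>\<^bsub>L.P.A\<^esub> y) = g2 x \<otimes>\<^bsub>Y2\<^esub> g2 y"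
    using assms
    by (intro Y2.ext_mult semilinear_f) (simp_all add: Y.L.mult_distr act_mult_Y, rule Y.L.mult_comm)
  then show ?thesis by simp
qed

lemma g1_mult:
  assumes "x \<in> carrier M.P.A" "y \<in> carrier M.P.A"
  shows "g1 (x \<otimes>\<^bsub>M.P.A\<^esub> y) = g1 x \<otimes>\<^bsub>mid_alg Y\<^esub> g1 y"
proof -
  have "g1 (x \<otimes>\<^bsub>M.P.A\<^esub> y) = g1 x \<otimes>\<^bsub>Y1\<^esub> g1 y"
    using assms
    by (intro Y1.ext_mult semilinear_f) (simp_all add: Y.M.mult_distr act_mult_Y, rule Y.M.mult_comm)
  then show ?thesis by simp
qed

lemma g_bdry1:
  assumes "x \<in> carrier M.P.A"
  shows "bdry1 Y (g1 x) = bdry1 I x"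
  using R.abelian_group_axioms _ _ _ assms
proof (rule M.additive_eqI)
  show "bdry1 Y (g1 (M.gen m r)) = bdry1 I (M.gen m r)"
    if "m \<in> carrier (mid_alg D)" "r \<in> carrier R" for m r
    using that Y.equivariant1[unfolded base, of r "f1 m"] by (simp add: R.m_comm)
qed (auto simp: additive_map_def base)

lemma g_bdry2:
  assumes "x \<in> carrier L.P.A"
  shows "bdry2 Y (g2 x) = g1 (bdry2 I x)"
  using Y.M.abelian_group_axioms _ _ _ assms
proof (rule L.additive_eqI)
  show "bdry2 Y (g2 (L.gen l r)) = g1 (bdry2 I (L.gen l r))"
    if "l \<in> carrier (top_alg D)" "r \<in> carrier R" for l r
    using that Y.equivariant2[unfolded base, of r "f2 l"] by simp
qed (auto simp: additive_map_def)

lemma g_act_mid: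
  assumes a: "a \<in> carrier R" and "x \<in> carrier M.P.A"
  shows "g1 (act_mid I a x) = act_mid Y a (g1 x)"
  using Y.M.abelian_group_axioms _ _ _ assms(2)
  by (rule M.additive_eqI) (use a in \<open>auto simp: additive_map_def\<close>)

lemma g_act_top:
  assumes a: "a \<in> carrier R" and "x \<in> carrier L.P.A"
  shows "g2 (act_top I a x) = act_top Y a (g2 x)"
  using Y.L.abelian_group_axioms _ _ _ assms(2)
  by (rule L.additive_eqI) (use a in \<open>auto simp: additive_map_def\<close>)

lemma g_lifting:
  assumes x: "x \<in> carrier M.P.A" and y: "y \<in> carrier M.P.A"
  shows "lifting Y (g1 x) (g1 y) = g2 (lifting I x y)"
proof (rule M.additive_eqI[OF Y.L.abelian_group_axioms, where x = x])
  fix m r assume m: "m \<in> carrier (mid_alg D)" "r \<in> carrier R"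
  show "lifting Y (g1 (M.gen m r)) (g1 y) = g2 (lifting I (M.gen m r) y)"
  proof (rule M.additive_eqI[OF Y.L.abelian_group_axioms, where x = y])
    fix n q assume "n \<in> carrier (mid_alg D)" "q \<in> carrier R"
    then show "lifting Y (g1 (M.gen m r)) (g1 (M.gen n q)) = g2 (lifting I (M.gen m r) (M.gen n q))"
      \<comment> \<open>\<open>PL5a\<close> and \<open>PL5b\<close> in \<open>Y\<close> move both
        scalars out of the lifting; the swap accounts for the order in which they come out.\<close>
      using m Y2.smult_swap[of q r "f2 (lifting D m n)"]
      by (simp flip: Y.PL5a[unfolded base] Y.PL5b[unfolded base])
  qed (use m y in \<open>auto simp: additive_map_def simp del: g1_simps(4)\<close>)
qed (use x y in \<open>auto simp: additive_map_def\<close>)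

lemma hom_factor: "two_crossed_hom K I Y g2 g1 id"
  by (simp add: two_crossed_hom_def alg_hom_def algebras base Pi_iff g2_mult g1_mult g_bdry1 g_bdry2
      g_act_mid g_act_top g_lifting)

lemma factor_comm:
  "l \<in> carrier (top_alg D) \<Longrightarrow> g2 (L.gen l \<one>\<^bsub>R\<^esub>) = f2 l"
  "m \<in> carrier (mid_alg D) \<Longrightarrow> g1 (M.gen m \<one>\<^bsub>R\<^esub>) = f1 m"
  by simp_all

lemma g_additive: "additive_map L.P.A (top_alg Y) g2" "additive_map M.P.A (mid_alg Y) g1"
  by (auto simp: additive_map_def)

text \<open>\<open>(l, r)\<close> is the result of \<open>r\<close> acting on \<open>(l, 1)\<close>.
  The value at \<open>(l, 1)\<close> is prescribed and equivariance under \<open>R\<close> gives the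
  value at \<open>(l, r)\<close>, so the factorization is determined on generators; the same holds
  for the middle algebra.\<close>

lemma factor_unique:
  assumes hom': "two_crossed_hom K I Y g2' g1' id"
    and comm2: "\<And>l. l \<in> carrier (top_alg D) \<Longrightarrow> g2' (L.gen l \<one>\<^bsub>R\<^esub>) = f2 l"
    and comm1: "\<And>m. m \<in> carrier (mid_alg D) \<Longrightarrow> g1' (M.gen m \<one>\<^bsub>R\<^esub>) = f1 m"
  shows "x \<in> carrier L.P.A \<Longrightarrow> g2' x = g2 x"
    and "y \<in> carrier M.P.A \<Longrightarrow> g1' y = g1 y"
proof -
  have "additive_map (top_alg I) (top_alg Y) g2'" "additive_map (mid_alg I) (mid_alg Y) g1'"
    using hom' unfolding two_crossed_hom_def by (blast intro: alg_hom_additive)+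
  then have add: "additive_map L.P.A (top_alg Y) g2'" "additive_map M.P.A (mid_alg Y) g1'"
    unfolding additive_map_def algebras restrict_scalars_simps .
  have act: "\<lbrakk>a \<in> carrier R; x \<in> carrier L.P.A\<rbrakk> \<Longrightarrow> g2' (act_top I a x) = act_top Y a (g2' x)"
    "\<lbrakk>a \<in> carrier R; y \<in> carrier M.P.A\<rbrakk> \<Longrightarrow> g1' (act_mid I a y) = act_mid Y a (g1' y)" for a x y
    using hom' unfolding two_crossed_hom_def algebras restrict_scalars_simps by simp_all
  have "g2' (L.gen l r) = g2 (L.gen l r)" if "l \<in> carrier (top_alg D)" "r \<in> carrier R" for l r
    using act(1)[of r "L.gen l \<one>\<^bsub>R\<^esub>"] that by (simp add: comm2)
  then show "x \<in> carrier L.P.A \<Longrightarrow> g2' x = g2 x"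
    by (rule L.additive_eqI[OF Y.L.abelian_group_axioms add(1) g_additive(1)])
  have "g1' (M.gen m r) = g1 (M.gen m r)" if "m \<in> carrier (mid_alg D)" "r \<in> carrier R" for m r
    using act(2)[of r "M.gen m \<one>\<^bsub>R\<^esub>"] that by (simp add: comm1)
  then show "y \<in> carrier M.P.A \<Longrightarrow> g1' y = g1 y"
    by (rule M.additive_eqI[OF Y.M.abelian_group_axioms add(2) g_additive(2)])
qed

lemma factorization:
  "\<exists>g2 g1. two_crossed_hom K I Y g2 g1 id \<and>
     (\<forall>l\<in>carrier (top_alg D). g2 (L.gen l \<one>\<^bsub>R\<^esub>) = f2 l) \<and>
     (\<forall>m\<in>carrier (mid_alg D). g1 (M.gen m \<one>\<^bsub>R\<^esub>) = f1 m) \<and>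
     (\<forall>g2' g1'. two_crossed_hom K I Y g2' g1' id \<and>
        (\<forall>l\<in>carrier (top_alg D). g2' (L.gen l \<one>\<^bsub>R\<^esub>) = f2 l) \<and>
        (\<forall>m\<in>carrier (mid_alg D). g1' (M.gen m \<one>\<^bsub>R\<^esub>) = f1 m) \<longrightarrow>
        (\<forall>x\<in>carrier (top_alg I). g2' x = g2 x) \<and> (\<forall>y\<in>carrier (mid_alg I). g1' y = g1 y))"
  unfolding algebras restrict_scalars_simps
proof (intro exI[of _ g2] exI[of _ g1] conjI allI impI)
  show "two_crossed_hom K I Y g2 g1 id" by (rule hom_factor)
  show "\<forall>l\<in>carrier (top_alg D). g2 (L.gen l \<one>\<^bsub>R\<^esub>) = f2 l"
    "\<forall>m\<in>carrier (mid_alg D). g1 (M.gen m \<one>\<^bsub>R\<^esub>) = f1 m"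
    by (intro ballI factor_comm; assumption)+
next
  fix g2' g1'
  assume "two_crossed_hom K I Y g2' g1' id \<and>
    (\<forall>l\<in>carrier (top_alg D). g2' (L.gen l \<one>\<^bsub>R\<^esub>) = f2 l) \<and>
    (\<forall>m\<in>carrier (mid_alg D). g1' (M.gen m \<one>\<^bsub>R\<^esub>) = f1 m)"
  then have *: "two_crossed_hom K I Y g2' g1' id"
    "\<And>l. l \<in> carrier (top_alg D) \<Longrightarrow> g2' (L.gen l \<one>\<^bsub>R\<^esub>) = f2 l"
    "\<And>m. m \<in> carrier (mid_alg D) \<Longrightarrow> g1' (M.gen m \<one>\<^bsub>R\<^esub>) = f1 m"
    by blast+
  show "\<forall>x\<in>carrier L.P.A. g2' x = g2 x" "\<forall>y\<in>carrier M.P.A. g1' y = g1 y"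
    by (intro ballI factor_unique[OF *]; assumption)+
qed

end

lemma (in presented_base_change) is_induced:
  "is_induced TYPE('b2 \<times> 'b1) K D R phi I (\<lambda>l. L.gen l \<one>\<^bsub>R\<^esub>) (\<lambda>m. M.gen m \<one>\<^bsub>R\<^esub>)"
  unfolding is_induced_def
proof (intro conjI allI impI)
  fix Y :: "('k, 'b2, 'b1, 'r) two_crossed" and f2 f1
  assume "two_crossed_module K Y \<and> base_alg Y = R \<and> two_crossed_hom K D Y f2 f1 phi"
  then have "base_change_factorization K R D phi I Y f2 f1"
    by (intro base_change_factorization.intro presented_base_change_axioms two_crossed.intro
        base_change_factorization_axioms.intro) blast+
  then show "\<exists>g2 g1. two_crossed_hom K I Y g2 g1 id \<and>
     (\<forall>l\<in>carrier (top_alg D). g2 (L.gen l \<one>\<^bsub>R\<^esub>) = f2 l) \<and>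
     (\<forall>m\<in>carrier (mid_alg D). g1 (M.gen m \<one>\<^bsub>R\<^esub>) = f1 m) \<and>
     (\<forall>g2' g1'. two_crossed_hom K I Y g2' g1' id \<and>
        (\<forall>l\<in>carrier (top_alg D). g2' (L.gen l \<one>\<^bsub>R\<^esub>) = f2 l) \<and>
        (\<forall>m\<in>carrier (mid_alg D). g1' (M.gen m \<one>\<^bsub>R\<^esub>) = f1 m) \<longrightarrow>
        (\<forall>x\<in>carrier (top_alg I). g2' x = g2 x) \<and> (\<forall>y\<in>carrier (mid_alg I). g1' y = g1 y))"
    by (rule base_change_factorization.factorization)
qed (rule I.two_crossed_module algebras hom_to_base_change)+

text \<open>Existence is asserted first, so the second conjunct is not vacuous: it gives the
  universal property for every 2-crossed module that fits the presentation, with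
  \<open>d |-> (d, 1)\<close> as the maps from \<open>D\<close>.\<close>

theorem proposition8:
  fixes K :: "'k ring" and R :: "('k, 'r) module"
    and D :: "('k, 'l, 'm, 's) two_crossed" and phi :: "'s \<Rightarrow> 'r"
  assumes "algebra K R"
    and "two_crossed_module K D"
    and "alg_hom K (base_alg D) R phi"
  shows "(\<exists>I. presented_two_crossed K R D phi I \<and> two_crossed_module K I) \<and>
    (\<forall>I. presented_two_crossed K R D phi I \<and> two_crossed_module K I \<longrightarrow>
       alg_action K (mid_alg I) (top_alg I) (\<lambda>x y. lifting I x (bdry2 I y)) \<and>
       is_induced TYPE('b2 \<times> 'b1) K D R phi I
         (\<lambda>d2. top_gen K R D phi d2 \<one>\<^bsub>R\<^esub>) (\<lambda>d1. mid_gen K R D phi d1 \<one>\<^bsub>R\<^esub>))"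
proof -
  have "two_crossed_base_change K R D phi"
    using assms
    by (intro two_crossed_base_change.intro two_crossed.intro two_crossed_base_change_axioms.intro)
  then interpret two_crossed_base_change K R D phi .
  show ?thesis
  proof (intro conjI allI impI)
    show "\<exists>I. presented_two_crossed K R D phi I \<and> two_crossed_module K I"
      using presented_base_changed two_crossed_module_base_changed by blast
  next
    fix I assume "presented_two_crossed K R D phi I \<and> two_crossed_module K I"
    then have I: "presented_base_change K R D phi I"
      by (intro presented_base_change.intro two_crossed_base_change_axioms two_crossed.intro
          presented_base_change_axioms.intro) blast+
    show "alg_action K (mid_alg I) (top_alg I) (\<lambda>x y. lifting I x (bdry2 I y))"
      by (rule two_crossed.lifting_action[OF presented_base_change.axioms(2)[OF I]])
    show "is_induced TYPE('b2 \<times> 'b1) K D R phi I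
         (\<lambda>d2. top_gen K R D phi d2 \<one>\<^bsub>R\<^esub>) (\<lambda>d1. mid_gen K R D phi d1 \<one>\<^bsub>R\<^esub>)"
      unfolding mid_eqs top_eqs by (rule presented_base_change.is_induced[OF I])
  qed
qed

end
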